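(* Let $2<p<\infty$, let $(w_n)$ be a sequence in $(0,1]$ decreasing to $0$, and let $w_{n,k}=w_n$ for all $n,k\in\mathbb N$. Let $(x_{n,k})$ and $(y_{m,j})$ be two copies of the natural basis of $X_{p,(w_{n,k})}$. Suppose that $T$ is a bounded operator on $X_{p,(w_{n,k})}\otimes X_{p,(w_{n,k})}$ and that there exists $\epsilon>0$ such that $$|(x_{n,k}^*\otimes y_{m,j}^* )(T(x_{n,k}\otimes y_{m,j}))|\ge\epsilon\quad\text{for all } n,k,m,j\in\mathbb N.$$ Then there are rich subsets $K,J$ of $\mathbb N\times\mathbb N$ such that the restriction of $T$ to the closed linear span $Z=[x_{n,k}\otimes y_{m,j}:(n,k)\in K,\ (m,j)\in J]$ is an isomorphism (onto its image). Moreover, $T(Z)$ is complemented (in $X_{p,(w_{n,k})}\otimes X_{p,(w_{n,k})}$).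
   Context: All spaces are real. For a family $(w_i)_{i\in I}$ in $(0,1]$ with $I$ countable, $X_{p,(w_i)}$ is the completion of the finitely supported families $(a_i)$ under $\max\{(\sum|a_i|^p)^{1/p},(\sum|a_i|^2w_i^2)^{1/2}\}$; its natural (standard) basis is the family of unit coordinate vectors. $X_{p,(w_i)}\otimes X_{p,(w_i)}$ is (up to equivalence of norms) the completion of the finitely supported families $\sum a_{i,i'}x_i\otimes y_{i'}$ under the norm which is the maximum of $(\sum_{i,i'}a_{i,i'}^2w_i^2w_{i'}^2)^{1/2}$, $(\sum_i(\sum_{i'}a_{i,i'}^2w_{i'}^2)^{p/2})^{1/p}$, $(\sum_{i'}(\sum_i a_{i,i'}^2w_i^2)^{p/2})^{1/p}$, $(\sum_{i,i'}|a_{i,i'}|^p)^{1/p}$; here the index set is $I=\mathbb N\times\mathbb N$. $x_{n,k}^*\otimes y_{m,j}^*$ denotes the coordinate functional biorthogonal to the basis $(x_{n,k}\otimes y_{m,j})$. A subset $S$ of $\mathbb N\times\mathbb N$ is rich if there is an infinite $M\subset\mathbb N$ such that for every $m\in M$ the set $\{(m,k)\in S:k\in\mathbb N\}$ is infinite. *)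

theory Defs
  imports "HOL-Analysis.Analysis"
begin

section \<open>Banach completions of finitely supported families\<close>

definition finsupp :: "('i \<Rightarrow> real) \<Rightarrow> bool" where
  "finsupp a \<longleftrightarrow> finite {i. a i \<noteq> 0}"

definition lincomb :: "('i \<Rightarrow> 'e::real_vector) \<Rightarrow> ('i \<Rightarrow> real) \<Rightarrow> 'e" where
  "lincomb b a = (\<Sum>i | a i \<noteq> 0. a i *\<^sub>R b i)"

text \<open>
  A completion is determined up to isometric isomorphism by its universal description, and the
  spaces below depend on real parameters, so they cannot be types built once and for all.
  Instead, the class \<open>banach\<close> supplies completeness of \<open>'e\<close>, and \<open>completion_basis N b\<close> says
  that \<open>'e\<close> is the completion of the finitely supported families under \<open>N\<close>, with \<open>b i\<close> the
  \<open>i\<close>-th unit coordinate vector.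
\<close>

definition completion_basis ::
  "(('i \<Rightarrow> real) \<Rightarrow> real) \<Rightarrow> ('i \<Rightarrow> 'e::banach) \<Rightarrow> bool" where
  "completion_basis N b \<longleftrightarrow>
     (\<forall>a. finsupp a \<longrightarrow> norm (lincomb b a) = N a) \<and>
     closure (span (range b)) = UNIV"

text \<open>The same up to an equivalent norm.\<close>

definition completion_basis_equiv ::
  "(('i \<Rightarrow> real) \<Rightarrow> real) \<Rightarrow> ('i \<Rightarrow> 'e::banach) \<Rightarrow> bool" where
  "completion_basis_equiv N b \<longleftrightarrow>
     (\<exists>c C. 0 < c \<and> 0 < C \<and>
        (\<forall>a. finsupp a \<longrightarrow>
           c * N a \<le> norm (lincomb b a) \<and> norm (lincomb b a) \<le> C * N a)) \<and>
     closure (span (range b)) = UNIV"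


section \<open>The space \<open>X\<^sub>p\<close> and its tensor square\<close>

text \<open>
  All sums in the two norms have only finitely many nonzero terms, because the norms are only
  used for finitely supported families. The exponents \<open>1/2\<close> are written as \<open>sqrt\<close>, and
  \<open>0 powr q = 0\<close>.
\<close>

definition Xp_norm :: "real \<Rightarrow> ('i \<Rightarrow> real) \<Rightarrow> ('i \<Rightarrow> real) \<Rightarrow> real" where
  "Xp_norm p w a =
     max ((\<Sum>\<^sub>\<infinity>i. \<bar>a i\<bar> powr p) powr (1 / p))
         (sqrt (\<Sum>\<^sub>\<infinity>i. (a i)\<^sup>2 * (w i)\<^sup>2))"

definition Xp_tensor_norm :: "real \<Rightarrow> ('i \<Rightarrow> real) \<Rightarrow> ('i \<times> 'i \<Rightarrow> real) \<Rightarrow> real" where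
  "Xp_tensor_norm p w a =
     Max {sqrt (\<Sum>\<^sub>\<infinity>(i, j). (a (i, j))\<^sup>2 * (w i)\<^sup>2 * (w j)\<^sup>2),
          (\<Sum>\<^sub>\<infinity>i. (\<Sum>\<^sub>\<infinity>j. (a (i, j))\<^sup>2 * (w j)\<^sup>2) powr (p / 2)) powr (1 / p),
          (\<Sum>\<^sub>\<infinity>j. (\<Sum>\<^sub>\<infinity>i. (a (i, j))\<^sup>2 * (w i)\<^sup>2) powr (p / 2)) powr (1 / p),
          (\<Sum>\<^sub>\<infinity>(i, j). \<bar>a (i, j)\<bar> powr p) powr (1 / p)}"

definition Xp_natural_basis ::
  "real \<Rightarrow> ('i::countable \<Rightarrow> real) \<Rightarrow> ('i \<Rightarrow> 'x::banach) \<Rightarrow> bool" where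
  "Xp_natural_basis p w x \<longleftrightarrow> completion_basis (Xp_norm p w) x"

definition tensor_basis :: "('x \<Rightarrow> 'y \<Rightarrow> 'e) \<Rightarrow> ('i \<Rightarrow> 'x) \<Rightarrow> ('j \<Rightarrow> 'y) \<Rightarrow> 'i \<times> 'j \<Rightarrow> 'e" where
  "tensor_basis tens x y = (\<lambda>(i, j). tens (x i) (y j))"

text \<open>
  \<open>'e\<close> is the tensor product of the two copies \<open>'x\<close>, \<open>'y\<close> of the space with natural bases
  \<open>x\<close>, \<open>y\<close>, and \<open>tens u v\<close> is the elementary tensor \<open>u \<otimes> v\<close>.
\<close>

definition Xp_tensor_product ::
  "real \<Rightarrow> ('i::countable \<Rightarrow> real) \<Rightarrow> ('i \<Rightarrow> 'x::banach) \<Rightarrow> ('i \<Rightarrow> 'y::banach) \<Rightarrow>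
   ('x \<Rightarrow> 'y \<Rightarrow> 'e::banach) \<Rightarrow> bool" where
  "Xp_tensor_product p w x y tens \<longleftrightarrow>
     Xp_natural_basis p w x \<and> Xp_natural_basis p w y \<and>
     bounded_bilinear tens \<and>
     completion_basis_equiv (Xp_tensor_norm p w) (tensor_basis tens x y)"


section \<open>Coordinate functionals\<close>

definition is_coord_functional ::
  "('i \<Rightarrow> 'e::real_normed_vector) \<Rightarrow> 'i \<Rightarrow> ('e \<Rightarrow> real) \<Rightarrow> bool" where
  "is_coord_functional b i f \<longleftrightarrow>
     bounded_linear f \<and> (\<forall>j. f (b j) = (if j = i then 1 else 0))"

text \<open>
  The description is proper for the tensor basis: see \<open>Xp_tensor_coord_functional\<close> below.
\<close>

definition coord_functional ::
  "('i \<Rightarrow> 'e::real_normed_vector) \<Rightarrow> 'i \<Rightarrow> 'e \<Rightarrow> real" where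
  "coord_functional b i = (THE f. is_coord_functional b i f)"


section \<open>Operators and rich sets\<close>

text \<open>
  The restriction to \<open>Z\<close> of a bounded operator is an isomorphism onto its image iff it is a
  homeomorphism, the inverse being automatically linear.
\<close>

definition isomorphism_into_on ::
  "('e::real_normed_vector) set \<Rightarrow> ('e \<Rightarrow> 'f::real_normed_vector) \<Rightarrow> bool" where
  "isomorphism_into_on Z T \<longleftrightarrow>
     subspace Z \<and> bounded_linear T \<and> (\<exists>g. homeomorphism Z (T ` Z) T g)"

definition complemented :: "('e::real_normed_vector) set \<Rightarrow> bool" where
  "complemented Y \<longleftrightarrow> (\<exists>P. bounded_linear P \<and> P \<circ> P = P \<and> range P = Y)"

definition rich :: "(nat \<times> nat) set \<Rightarrow> bool" where
  "rich S \<longleftrightarrow> (\<exists>M. infinite M \<and> (\<forall>m\<in>M. infinite {(m, k) | k. (m, k) \<in> S}))"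


section \<open>The coordinate functionals of the tensor basis exist and are unique\<close>

lemma is_coord_functional_unique:
  assumes "closure (span (range b)) = UNIV"
    and "is_coord_functional b i f" "is_coord_functional b i g"
  shows "f = g"
proof
  fix v
  have lf: "bounded_linear f" and lg: "bounded_linear g"
    using assms by (auto simp: is_coord_functional_def)
  have "f u = g u" if "u \<in> span (range b)" for u
    using that
    by (rule linear_eq_on_span[where B = "range b", rotated 3])
       (use assms lf lg in \<open>auto simp: is_coord_functional_def bounded_linear.linear\<close>)
  moreover have "continuous_on UNIV f" "continuous_on UNIV g"
    using lf lg by (auto intro: linear_continuous_on)
  ultimately show "f v = g v"
    using assms(1) continuous_constant_on_closure[of "span (range b)" "\<lambda>u. f u - g u" 0 v]
    by (auto intro: continuous_on_diff)
qed

lemma bounded_linear_extension: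
  fixes f :: "'e::real_normed_vector \<Rightarrow> real"
  assumes S: "subspace S" "closure S = UNIV"
    and add: "\<And>u v. u \<in> S \<Longrightarrow> v \<in> S \<Longrightarrow> f (u + v) = f u + f v"
    and scale: "\<And>r u. u \<in> S \<Longrightarrow> f (r *\<^sub>R u) = r * f u"
    and bd: "\<And>u. u \<in> S \<Longrightarrow> \<bar>f u\<bar> \<le> C * norm u"
  obtains g where "bounded_linear g" "\<And>u. u \<in> S \<Longrightarrow> g u = f u"
proof -
  have "\<bar>C\<bar>-lipschitz_on S f"
  proof (rule lipschitz_onI)
    fix u v assume uv: "u \<in> S" "v \<in> S"
    have "f u = f (u - v) + f v"
      using add[of "u - v" v] uv S(1) by (simp add: subspace_diff)
    hence "dist (f u) (f v) = \<bar>f (u - v)\<bar>" by (simp add: dist_real_def)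
    also have "\<dots> \<le> C * norm (u - v)" using uv S(1) by (intro bd) (simp add: subspace_diff)
    also have "\<dots> \<le> \<bar>C\<bar> * dist u v" by (simp add: dist_norm mult_right_mono)
    finally show "dist (f u) (f v) \<le> \<bar>C\<bar> * dist u v" .
  qed simp
  then obtain g where g: "uniformly_continuous_on (closure S) g" "\<And>u. u \<in> S \<Longrightarrow> f u = g u"
    using uniformly_continuous_on_extension_on_closure[OF lipschitz_on_uniformly_continuous]
    by metis
  have cont: "continuous_on UNIV g"
    using g(1) S(2) by (simp add: uniformly_continuous_imp_continuous)
  have conv: "(\<lambda>n. g (s n)) \<longlonglongrightarrow> g u" if "s \<longlonglongrightarrow> u" for s u
    using cont that by (simp add: continuous_on_eq_continuous_at isCont_tendsto_compose)
  have app: "\<exists>s. (\<forall>n. s n \<in> S) \<and> s \<longlonglongrightarrow> u" for u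
    using S(2) closure_sequential[of u S] by auto
  have "bounded_linear g"
  proof (rule bounded_linear_intro[where K = C])
    fix u v
    obtain s t where st: "\<And>n. s n \<in> S" "s \<longlonglongrightarrow> u" "\<And>n. t n \<in> S" "t \<longlonglongrightarrow> v"
      using app by metis
    have "(\<lambda>n. g (s n + t n)) \<longlonglongrightarrow> g (u + v)" by (intro conv tendsto_add st)
    moreover have "g (s n + t n) = g (s n) + g (t n)" for n
      using add[of "s n" "t n"] st S(1) g(2) by (metis subspace_add)
    moreover have "(\<lambda>n. g (s n) + g (t n)) \<longlonglongrightarrow> g u + g v" by (intro tendsto_add conv st)
    ultimately show "g (u + v) = g u + g v" using LIMSEQ_unique by fastforce
  next
    fix r u
    obtain s where s: "\<And>n. s n \<in> S" "s \<longlonglongrightarrow> u" using app by metis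
    have "(\<lambda>n. g (r *\<^sub>R s n)) \<longlonglongrightarrow> g (r *\<^sub>R u)" by (intro conv tendsto_intros s)
    moreover have "g (r *\<^sub>R s n) = r *\<^sub>R g (s n)" for n
      using scale[of "s n" r] s S(1) g(2) by (metis subspace_scale real_scaleR_def)
    moreover have "(\<lambda>n. r *\<^sub>R g (s n)) \<longlonglongrightarrow> r *\<^sub>R g u" by (intro tendsto_intros conv s)
    ultimately show "g (r *\<^sub>R u) = r *\<^sub>R g u" using LIMSEQ_unique by fastforce
  next
    fix u
    obtain s where s: "\<And>n. s n \<in> S" "s \<longlonglongrightarrow> u" using app by metis
    have "(\<lambda>n. norm (g (s n))) \<longlonglongrightarrow> norm (g u)" by (intro tendsto_intros conv s)
    moreover have "(\<lambda>n. norm (s n) * C) \<longlonglongrightarrow> norm u * C" by (intro tendsto_intros s)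
    moreover have "norm (g (s n)) \<le> norm (s n) * C" for n
      using bd[OF s(1)[of n]] g(2)[OF s(1)[of n]] by (simp add: mult.commute)
    ultimately show "norm (g u) \<le> norm u * C" by (intro LIMSEQ_le) auto
  qed
  thus ?thesis using g(2) that by metis
qed

lemma lincomb_superset:
  assumes "finite F" "{i. a i \<noteq> 0} \<subseteq> F"
  shows "lincomb b a = (\<Sum>i\<in>F. a i *\<^sub>R b i)"
  unfolding lincomb_def by (rule sum.mono_neutral_left) (use assms in auto)

lemma lincomb_add:
  assumes "finsupp a" "finsupp a'"
  shows "lincomb b (\<lambda>i. a i + a' i) = lincomb b a + lincomb b a'"
proof -
  let ?F = "{i. a i \<noteq> 0} \<union> {i. a' i \<noteq> 0}"
  have F: "finite ?F" using assms by (simp add: finsupp_def)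
  show ?thesis
    using lincomb_superset[OF F, of a b] lincomb_superset[OF F, of a' b]
      lincomb_superset[OF F, of "\<lambda>i. a i + a' i" b]
    by (auto simp: scaleR_add_left sum.distrib subset_iff)
qed

lemma lincomb_scale:
  assumes "finsupp a"
  shows "lincomb b (\<lambda>i. r * a i) = r *\<^sub>R lincomb b a"
proof -
  have "finite {i. a i \<noteq> 0}" using assms by (simp add: finsupp_def)
  from lincomb_superset[OF this, of a b] lincomb_superset[OF this, of "\<lambda>i. r * a i" b]
  show ?thesis by (auto simp: scaleR_sum_right)
qed

lemma finsupp_add: "finsupp a \<Longrightarrow> finsupp a' \<Longrightarrow> finsupp (\<lambda>i. a i + a' i)"
  unfolding finsupp_def by (rule finite_subset[of _ "{i. a i \<noteq> 0} \<union> {i. a' i \<noteq> 0}"]) auto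

lemma finsupp_scale: "finsupp a \<Longrightarrow> finsupp (\<lambda>i. r * a i)"
  unfolding finsupp_def by (rule finite_subset[of _ "{i. a i \<noteq> 0}"]) auto

lemma finsupp_unit: "finsupp (\<lambda>j. if j = i then 1 else 0)"
  by (simp add: finsupp_def)

lemma lincomb_unit: "lincomb b (\<lambda>j. if j = i then 1 else 0) = b i"
  by (simp add: lincomb_def)

lemma coord_functional_exists:
  fixes b :: "'i \<Rightarrow> 'e::real_normed_vector"
  assumes dense: "closure (span (range b)) = UNIV"
    and bd: "\<And>a j. finsupp a \<Longrightarrow> \<bar>a j\<bar> \<le> C * norm (lincomb b a)"
  shows "\<exists>!f. is_coord_functional b i f"
proof -
  define S where "S = lincomb b ` Collect finsupp"
  have diff: "a = a'" if "finsupp a" "finsupp a'" "lincomb b a = lincomb b a'" for a a'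
  proof
    fix j
    have "lincomb b (\<lambda>i. a i + (-1) * a' i) = 0"
      unfolding lincomb_add[OF that(1) finsupp_scale[OF that(2)]] lincomb_scale[OF that(2)]
      using that(3) by simp
    with bd[OF finsupp_add[OF that(1) finsupp_scale[OF that(2), of "-1"]], of j]
    show "a j = a' j" by simp
  qed
  have zero: "0 \<in> S"
    using image_eqI[of 0 "lincomb b" "\<lambda>_. 0"] by (simp add: S_def finsupp_def lincomb_def)
  have sub: "subspace S"
  proof (rule subspaceI[OF zero])
    fix u v assume "u \<in> S" "v \<in> S"
    then obtain a a' where a: "finsupp a" "finsupp a'" "u = lincomb b a" "v = lincomb b a'"
      by (auto simp: S_def)
    show "u + v \<in> S"
      unfolding S_def a(3,4) lincomb_add[OF a(1,2), symmetric]
      using finsupp_add[OF a(1,2)] by blast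
  next
    fix r u assume "u \<in> S"
    then obtain a where a: "finsupp a" "u = lincomb b a" by (auto simp: S_def)
    show "r *\<^sub>R u \<in> S"
      unfolding S_def a(2) lincomb_scale[OF a(1), symmetric]
      using finsupp_scale[OF a(1)] by blast
  qed
  have "range b \<subseteq> S"
  proof
    fix v assume "v \<in> range b"
    then obtain j where "v = lincomb b (\<lambda>k. if k = j then 1 else 0)"
      by (auto simp: lincomb_unit)
    then show "v \<in> S" unfolding S_def using finsupp_unit[of j] by blast
  qed
  hence "span (range b) \<subseteq> S" using sub by (simp add: span_minimal)
  hence cl: "closure S = UNIV" using dense closure_mono by blast
  define f where "f v = (THE a. finsupp a \<and> lincomb b a = v) i" for v
  have f: "f (lincomb b a) = a i" if "finsupp a" for a
  proof -
    have "(THE a'. finsupp a' \<and> lincomb b a' = lincomb b a) = a"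
      by (rule the_equality) (use that diff in auto)
    thus ?thesis by (simp add: f_def)
  qed
  have fadd: "f (u + v) = f u + f v" if uv: "u \<in> S" "v \<in> S" for u v
  proof -
    obtain a a' where "finsupp a" "finsupp a'" "u = lincomb b a" "v = lincomb b a'"
      using uv by (auto simp: S_def)
    thus ?thesis using f[OF finsupp_add[of a a']] by (simp add: lincomb_add f)
  qed
  have fscale: "f (r *\<^sub>R u) = r * f u" if u: "u \<in> S" for r u
  proof -
    obtain a where "finsupp a" "u = lincomb b a" using u by (auto simp: S_def)
    thus ?thesis using f[OF finsupp_scale[of a r]] by (simp add: lincomb_scale f)
  qed
  have fbd: "\<bar>f u\<bar> \<le> C * norm u" if "u \<in> S" for u
    using that bd f by (auto simp: S_def)
  obtain g where g: "bounded_linear g" "\<And>u. u \<in> S \<Longrightarrow> g u = f u"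
    using bounded_linear_extension[OF sub cl fadd fscale fbd] by metis
  have "g (b j) = (if j = i then 1 else 0)" for j
    using g(2)[of "b j"] subsetD[OF \<open>range b \<subseteq> S\<close> rangeI[of b j]] f[OF finsupp_unit[of j]]
    by (auto simp: lincomb_unit)
  hence "is_coord_functional b i g" using g(1) by (simp add: is_coord_functional_def)
  thus ?thesis using is_coord_functional_unique[OF dense] by blast
qed

lemma coord_le_Xp_tensor_norm:
  assumes p: "0 < p" and a: "finsupp a"
  shows "\<bar>a j\<bar> \<le> Xp_tensor_norm p w a"
proof -
  let ?A = "{i. a i \<noteq> 0} \<union> {j}"
  have fin: "finite ?A" using a by (simp add: finsupp_def)
  have "(\<Sum>\<^sub>\<infinity>(i, k). \<bar>a (i, k)\<bar> powr p) = (\<Sum>\<^sub>\<infinity>i\<in>?A. \<bar>a i\<bar> powr p)"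
    by (rule infsum_cong_neutral) auto
  also have "\<dots> = (\<Sum>i\<in>?A. \<bar>a i\<bar> powr p)" using fin by (rule infsum_finite)
  finally have eq: "(\<Sum>\<^sub>\<infinity>(i, k). \<bar>a (i, k)\<bar> powr p) = (\<Sum>i\<in>?A. \<bar>a i\<bar> powr p)" .
  have "\<bar>a j\<bar> powr p \<le> (\<Sum>i\<in>?A. \<bar>a i\<bar> powr p)"
    by (rule member_le_sum) (use fin in auto)
  hence "(\<bar>a j\<bar> powr p) powr (1 / p) \<le> (\<Sum>i\<in>?A. \<bar>a i\<bar> powr p) powr (1 / p)"
    using p by (intro powr_mono2) auto
  hence "\<bar>a j\<bar> \<le> (\<Sum>\<^sub>\<infinity>(i, k). \<bar>a (i, k)\<bar> powr p) powr (1 / p)"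
    using p eq by (simp add: powr_powr)
  also have "\<dots> \<le> Xp_tensor_norm p w a"
    unfolding Xp_tensor_norm_def by (rule Max_ge) auto
  finally show ?thesis .
qed

lemma Xp_tensor_coord_functional:
  assumes "2 < p" and "Xp_tensor_product p w x y tens"
  shows "\<exists>!f. is_coord_functional (tensor_basis tens x y) ij f"
    and "is_coord_functional (tensor_basis tens x y) ij
           (coord_functional (tensor_basis tens x y) ij)"
proof -
  let ?b = "tensor_basis tens x y"
  from assms obtain c where c: "0 < c"
    "\<And>a. finsupp a \<Longrightarrow> c * Xp_tensor_norm p w a \<le> norm (lincomb ?b a)"
    and dense: "closure (span (range ?b)) = UNIV"
    by (auto simp: Xp_tensor_product_def completion_basis_equiv_def)
  have "\<bar>a j\<bar> \<le> inverse c * norm (lincomb ?b a)" if "finsupp a" for a j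
  proof -
    have "c * \<bar>a j\<bar> \<le> norm (lincomb ?b a)"
      using coord_le_Xp_tensor_norm[of p a j w] c that assms(1)
      by (smt (verit) mult_left_mono)
    thus ?thesis using c(1) by (simp add: field_simps)
  qed
  with dense show ex: "\<exists>!f. is_coord_functional ?b ij f" by (rule coord_functional_exists)
  show "is_coord_functional ?b ij (coord_functional ?b ij)"
    unfolding coord_functional_def using ex by (rule theI')
qed

end

theory Submission
  imports Defs "HOL-Complex_Analysis.Great_Picard"
begin

text \<open>
  Write \<open>t a b a' b'\<close> for the coefficient of \<open>T (x\<^sub>a \<otimes> y\<^sub>b)\<close> at \<open>x\<^sub>a\<^sub>' \<otimes> y\<^sub>b\<^sub>'\<close>. Along \<open>a = (n, k)\<close>,
  \<open>k \<rightarrow> \<infinity>\<close>, the entries with one index moving tend to \<open>0\<close>, but the entries \<open>t a b a b'\<close> with the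
  same moving index on both sides only have limits \<open>s n b b'\<close> along a subsequence, and these have a
  limit \<open>S b b'\<close> as \<open>n \<rightarrow> \<infinity>\<close>; both limits again vanish along the columns. Choosing alternately
  elements \<open>a\<^sub>i\<close> and \<open>b\<^sub>j\<close>, one gets rich sets on which entries with \<open>i \<noteq> i'\<close> and \<open>j \<noteq> j'\<close> are summable
  with a small sum, while the entries with \<open>i = i'\<close> and \<open>j \<noteq> j'\<close> are at most \<open>\<eta> 2\<^sup>-\<^sup>j\<^sup>-\<^sup>j\<^sup>'\<close> uniformly
  in \<open>i\<close>. The latter suffices, since for fixed \<open>j\<close> and \<open>j'\<close> they form a diagonal operator from row \<open>j\<close>
  to row \<open>j'\<close>, and all rows carry the same norm. Hence, after composing with the inverse \<open>U\<close> of the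
  diagonal, \<open>U T\<close> is within \<open>1/2\<close> of the identity on \<open>Z\<close>, which makes \<open>T\<close> an isomorphism on \<open>Z\<close> and
  provides a projection onto \<open>T Z\<close>.
\<close>

section \<open>The tensor norm\<close>

lemma infsum_eq_sum:
  fixes f :: "'a \<Rightarrow> real"
  assumes "finite F" "\<And>x. x \<notin> F \<Longrightarrow> f x = 0"
  shows "infsum f UNIV = sum f F"
proof -
  have "infsum f UNIV = infsum f F"
    by (rule infsum_cong_neutral) (use assms in auto)
  then show ?thesis
    using assms(1) by simp
qed

lemma Xp_norm_eq_sum:
  assumes "finite A" "{i. a i \<noteq> 0} \<subseteq> A"
  shows "Xp_norm p w a = max ((\<Sum>i\<in>A. \<bar>a i\<bar> powr p) powr (1 / p)) (sqrt (\<Sum>i\<in>A. (a i)\<^sup>2 * (w i)\<^sup>2))"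
  unfolding Xp_norm_def using assms by (subst (1 2) infsum_eq_sum[of A]) auto

lemma Xp_tensor_norm_eq_sum:
  assumes A: "finite A" and B: "finite B" and a: "{u. a u \<noteq> 0} \<subseteq> A \<times> B"
  shows "Xp_tensor_norm p w a =
     Max {sqrt (\<Sum>i\<in>A. \<Sum>j\<in>B. (a (i, j))\<^sup>2 * (w i)\<^sup>2 * (w j)\<^sup>2),
          (\<Sum>i\<in>A. (\<Sum>j\<in>B. (a (i, j))\<^sup>2 * (w j)\<^sup>2) powr (p / 2)) powr (1 / p),
          (\<Sum>j\<in>B. (\<Sum>i\<in>A. (a (i, j))\<^sup>2 * (w i)\<^sup>2) powr (p / 2)) powr (1 / p),
          (\<Sum>i\<in>A. \<Sum>j\<in>B. \<bar>a (i, j)\<bar> powr p) powr (1 / p)}"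
proof -
  have a0: "a (i, j) = 0" if "i \<notin> A \<or> j \<notin> B" for i j
    using a that by blast
  have AB: "finite (A \<times> B)"
    using A B by simp
  have 1: "(\<Sum>\<^sub>\<infinity>(i, j). (a (i, j))\<^sup>2 * (w i)\<^sup>2 * (w j)\<^sup>2) = (\<Sum>i\<in>A. \<Sum>j\<in>B. (a (i, j))\<^sup>2 * (w i)\<^sup>2 * (w j)\<^sup>2)"
    by (subst infsum_eq_sum[OF AB]) (use a in \<open>auto simp: sum.cartesian_product\<close>)
  have 2: "(\<Sum>\<^sub>\<infinity>(i, j). \<bar>a (i, j)\<bar> powr p) = (\<Sum>i\<in>A. \<Sum>j\<in>B. \<bar>a (i, j)\<bar> powr p)"
    by (subst infsum_eq_sum[OF AB]) (use a in \<open>auto simp: sum.cartesian_product\<close>)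
  have 3: "(\<Sum>\<^sub>\<infinity>j. (a (i, j))\<^sup>2 * (w j)\<^sup>2) = (\<Sum>j\<in>B. (a (i, j))\<^sup>2 * (w j)\<^sup>2)" for i
    by (rule infsum_eq_sum[OF B]) (simp add: a0)
  have 4: "(\<Sum>\<^sub>\<infinity>i. (a (i, j))\<^sup>2 * (w i)\<^sup>2) = (\<Sum>i\<in>A. (a (i, j))\<^sup>2 * (w i)\<^sup>2)" for j
    by (rule infsum_eq_sum[OF A]) (simp add: a0)
  have 5: "(\<Sum>\<^sub>\<infinity>i. (\<Sum>j\<in>B. (a (i, j))\<^sup>2 * (w j)\<^sup>2) powr (p / 2)) =
      (\<Sum>i\<in>A. (\<Sum>j\<in>B. (a (i, j))\<^sup>2 * (w j)\<^sup>2) powr (p / 2))"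
    by (rule infsum_eq_sum[OF A]) (simp add: a0)
  have 6: "(\<Sum>\<^sub>\<infinity>j. (\<Sum>i\<in>A. (a (i, j))\<^sup>2 * (w i)\<^sup>2) powr (p / 2)) =
      (\<Sum>j\<in>B. (\<Sum>i\<in>A. (a (i, j))\<^sup>2 * (w i)\<^sup>2) powr (p / 2))"
    by (rule infsum_eq_sum[OF B]) (simp add: a0)
  show ?thesis
    unfolding Xp_tensor_norm_def 1 2 3 4 5 6 ..
qed

lemma finsupp_rectangle:
  assumes "finsupp (a :: 'i \<times> 'j \<Rightarrow> real)"
  obtains A B where "finite A" "finite B" "{u. a u \<noteq> 0} \<subseteq> A \<times> B"
proof
  let ?S = "{u. a u \<noteq> 0}"
  show "finite (fst ` ?S)" "finite (snd ` ?S)"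
    using assms by (simp_all add: finsupp_def)
  show "?S \<subseteq> fst ` ?S \<times> snd ` ?S"
    by force
qed

text \<open>Transposition exchanges the second and third terms of the maximum and fixes the other
  two. It lets the column formula follow from the row formula.\<close>

lemma Xp_tensor_norm_swap:
  assumes "finsupp a"
  shows "Xp_tensor_norm p w (\<lambda>(i, j). a (j, i)) = Xp_tensor_norm p w a"
proof -
  obtain A B where AB: "finite A" "finite B" and a: "{u. a u \<noteq> 0} \<subseteq> A \<times> B"
    using finsupp_rectangle[OF assms] by metis
  let ?a = "\<lambda>(i, j). a (j, i)"
  have a': "{u. ?a u \<noteq> 0} \<subseteq> B \<times> A"
    using a by auto
  have 1: "(\<Sum>i\<in>B. \<Sum>j\<in>A. (?a (i, j))\<^sup>2 * (w i)\<^sup>2 * (w j)\<^sup>2) = (\<Sum>i\<in>A. \<Sum>j\<in>B. (a (i, j))\<^sup>2 * (w i)\<^sup>2 * (w j)\<^sup>2)"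
    by (subst sum.swap) (simp add: mult_ac)
  have 2: "(\<Sum>i\<in>B. \<Sum>j\<in>A. \<bar>?a (i, j)\<bar> powr p) = (\<Sum>i\<in>A. \<Sum>j\<in>B. \<bar>a (i, j)\<bar> powr p)"
    by (subst sum.swap) simp
  show ?thesis
    unfolding Xp_tensor_norm_eq_sum[OF AB(1,2), of a, OF a] Xp_tensor_norm_eq_sum[OF AB(2,1), of ?a, OF a'] 1 2
    by (simp add: insert_commute)
qed

lemma Max4_le_mult:
  fixes x1 x2 x3 x4 :: real
  assumes "x1 \<le> L * y1" "x2 \<le> L * y2" "x3 \<le> L * y3" "x4 \<le> L * y4" "0 \<le> L"
  shows "Max {x1, x2, x3, x4} \<le> L * Max {y1, y2, y3, y4}"
proof -
  have "L * y \<le> L * Max {y1, y2, y3, y4}" if "y \<in> {y1, y2, y3, y4}" for y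
    using that assms(5) by (intro mult_left_mono Max_ge) auto
  then show ?thesis
    using assms by (subst Max_le_iff) (auto intro: order_trans)
qed

text \<open>The shape needed for the three terms of exponent \<open>p\<close>: a factor
  \<open>L\<close> on the coefficients appears as \<open>L powr p\<close> under the sum and comes
  out of the \<open>p\<close>-th root as \<open>L\<close>.\<close>

lemma powr_sum_mono_scaled:
  fixes f g :: "'a \<Rightarrow> real" and p L :: real
  assumes "0 < p" "0 \<le> L" "\<And>i. i \<in> A \<Longrightarrow> 0 \<le> f i" "\<And>i. i \<in> A \<Longrightarrow> 0 \<le> g i" "\<And>i. i \<in> A \<Longrightarrow> f i \<le> L powr p * g i"
  shows "(\<Sum>i\<in>A. f i) powr (1 / p) \<le> L * (\<Sum>i\<in>A. g i) powr (1 / p)"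
proof -
  have "(\<Sum>i\<in>A. f i) \<le> L powr p * (\<Sum>i\<in>A. g i)"
    using assms(5) unfolding sum_distrib_left by (rule sum_mono)
  then have "(\<Sum>i\<in>A. f i) powr (1 / p) \<le> (L powr p * (\<Sum>i\<in>A. g i)) powr (1 / p)"
    using assms(1,3) by (intro powr_mono2) (auto intro: sum_nonneg)
  also have "\<dots> = L * (\<Sum>i\<in>A. g i) powr (1 / p)"
    using assms by (simp add: powr_mult powr_powr sum_nonneg)
  finally show ?thesis .
qed

text \<open>All four terms depend on the absolute values of the coefficients only, monotonically and
  homogeneously. This is 1-unconditionality of the unit vectors, from which the bounds for diagonal
  operators and coordinate projections are derived.\<close>

lemma Xp_tensor_norm_mono:
  assumes p: "0 < p" and a: "finsupp a" and L: "0 \<le> L" and le: "\<And>u. \<bar>a' u\<bar> \<le> L * \<bar>a u\<bar>"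
  shows "Xp_tensor_norm p w a' \<le> L * Xp_tensor_norm p w a"
proof -
  obtain A B where AB: "finite A" "finite B" and a: "{u. a u \<noteq> 0} \<subseteq> A \<times> B"
    using finsupp_rectangle[OF a] by metis
  \<comment> \<open>Domination by a multiple of \<open>a\<close> forces the support of
    \<open>a'\<close> into the same rectangle, so both norms are finite sums over it.\<close>
  have "a' u = 0" if "a u = 0" for u
    using le[of u] that by simp
  then have a': "{u. a' u \<noteq> 0} \<subseteq> A \<times> B"
    using a by blast
  have sq: "(a' u)\<^sup>2 \<le> L\<^sup>2 * (a u)\<^sup>2" for u
    using power_mono[OF le[of u], of 2] by (simp add: power_mult_distrib)
  have sqw: "(a' u)\<^sup>2 * v\<^sup>2 \<le> L\<^sup>2 * ((a u)\<^sup>2 * v\<^sup>2)" for u v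
    using mult_right_mono[OF sq[of u], of "v\<^sup>2"] by (simp add: mult.assoc)
  have pw: "\<bar>a' u\<bar> powr p \<le> L powr p * \<bar>a u\<bar> powr p" for u
    using powr_mono2[OF _ _ le[of u], of p] p L by (simp add: powr_mult)
  have inner: "(\<Sum>i\<in>F. (a' (h i))\<^sup>2 * (w i)\<^sup>2) powr (p / 2) \<le>
      L powr p * (\<Sum>i\<in>F. (a (h i))\<^sup>2 * (w i)\<^sup>2) powr (p / 2)" for h :: "'a \<Rightarrow> 'a \<times> 'a" and F
  proof -
    have "(\<Sum>i\<in>F. (a' (h i))\<^sup>2 * (w i)\<^sup>2) \<le> L\<^sup>2 * (\<Sum>i\<in>F. (a (h i))\<^sup>2 * (w i)\<^sup>2)"
      unfolding sum_distrib_left by (rule sum_mono) (rule sqw)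
    then have "(\<Sum>i\<in>F. (a' (h i))\<^sup>2 * (w i)\<^sup>2) powr (p / 2) \<le> (L\<^sup>2 * (\<Sum>i\<in>F. (a (h i))\<^sup>2 * (w i)\<^sup>2)) powr (p / 2)"
      using p by (intro powr_mono2) (auto intro: sum_nonneg)
    also have "\<dots> = L powr p * (\<Sum>i\<in>F. (a (h i))\<^sup>2 * (w i)\<^sup>2) powr (p / 2)"
      using L p by (cases "L = 0") (simp_all add: powr_mult sum_nonneg powr_powr flip: powr_numeral)
    finally show ?thesis .
  qed
  show ?thesis
    unfolding Xp_tensor_norm_eq_sum[OF AB, of a, OF a] Xp_tensor_norm_eq_sum[OF AB, of a', OF a']
  proof (rule Max4_le_mult[OF _ _ _ _ L])
    have "(\<Sum>i\<in>A. \<Sum>j\<in>B. (a' (i, j))\<^sup>2 * (w i)\<^sup>2 * (w j)\<^sup>2) \<le>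
        L\<^sup>2 * (\<Sum>i\<in>A. \<Sum>j\<in>B. (a (i, j))\<^sup>2 * (w i)\<^sup>2 * (w j)\<^sup>2)"
      unfolding sum_distrib_left
    proof (intro sum_mono)
      fix i j
      show "(a' (i, j))\<^sup>2 * (w i)\<^sup>2 * (w j)\<^sup>2 \<le> L\<^sup>2 * ((a (i, j))\<^sup>2 * (w i)\<^sup>2 * (w j)\<^sup>2)"
        using sqw[of "(i, j)" "w i * w j"] by (simp add: power_mult_distrib mult.assoc)
    qed
    then show "sqrt (\<Sum>i\<in>A. \<Sum>j\<in>B. (a' (i, j))\<^sup>2 * (w i)\<^sup>2 * (w j)\<^sup>2)
        \<le> L * sqrt (\<Sum>i\<in>A. \<Sum>j\<in>B. (a (i, j))\<^sup>2 * (w i)\<^sup>2 * (w j)\<^sup>2)"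
      using real_sqrt_le_mono L by (fastforce simp: real_sqrt_mult)
    show "(\<Sum>i\<in>A. (\<Sum>j\<in>B. (a' (i, j))\<^sup>2 * (w j)\<^sup>2) powr (p / 2)) powr (1 / p)
        \<le> L * (\<Sum>i\<in>A. (\<Sum>j\<in>B. (a (i, j))\<^sup>2 * (w j)\<^sup>2) powr (p / 2)) powr (1 / p)"
      by (rule powr_sum_mono_scaled[OF p L]) (use inner[of "Pair _"] in auto)
    show "(\<Sum>j\<in>B. (\<Sum>i\<in>A. (a' (i, j))\<^sup>2 * (w i)\<^sup>2) powr (p / 2)) powr (1 / p)
        \<le> L * (\<Sum>j\<in>B. (\<Sum>i\<in>A. (a (i, j))\<^sup>2 * (w i)\<^sup>2) powr (p / 2)) powr (1 / p)"
      by (rule powr_sum_mono_scaled[OF p L]) (use inner[of "\<lambda>i. (i, _)"] in auto)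
    show "(\<Sum>i\<in>A. \<Sum>j\<in>B. \<bar>a' (i, j)\<bar> powr p) powr (1 / p)
        \<le> L * (\<Sum>i\<in>A. \<Sum>j\<in>B. \<bar>a (i, j)\<bar> powr p) powr (1 / p)"
      unfolding sum.cartesian_product
      by (rule powr_sum_mono_scaled[OF p L]) (use pw in auto)
  qed
qed

text \<open>With \<open>w b \<le> 1\<close> the first term is dominated by the third and the second
  by the fourth; the two survivors are exactly the two terms of \<open>Xp_norm\<close>, so
  \<open>w b\<close> drops out.\<close>

lemma Xp_tensor_norm_row:
  assumes p: "0 < p" and w: "0 \<le> w b" "w b \<le> 1" and g: "finsupp \<gamma>"
  shows "Xp_tensor_norm p w (\<lambda>(i, j). if j = b then \<gamma> i else 0) = Xp_norm p w \<gamma>"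
proof -
  let ?a = "\<lambda>(i, j). if j = b then \<gamma> i else 0"
  define A where "A = {i. \<gamma> i \<noteq> 0}"
  have A: "finite A" "{i. \<gamma> i \<noteq> 0} \<subseteq> A"
    using g by (auto simp: A_def finsupp_def)
  have a: "{u. ?a u \<noteq> 0} \<subseteq> A \<times> {b}"
    using A(2) by (auto split: if_splits)
  have w2: "(w b)\<^sup>2 \<le> 1"
    using w by (simp add: power_le_one)
  define X where "X = (\<Sum>i\<in>A. (\<gamma> i)\<^sup>2 * (w i)\<^sup>2)"
  define Y where "Y = (\<Sum>i\<in>A. \<bar>\<gamma> i\<bar> powr p)"
  have "0 \<le> X"
    by (simp add: X_def sum_nonneg)
  have 1: "sqrt (\<Sum>i\<in>A. (\<gamma> i)\<^sup>2 * (w i)\<^sup>2 * (w b)\<^sup>2) \<le> sqrt X"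
    unfolding X_def by (intro real_sqrt_le_mono sum_mono) (use w2 in \<open>simp add: mult_left_le\<close>)
  have 3: "(X powr (p / 2)) powr (1 / p) = sqrt X"
    using p \<open>0 \<le> X\<close> by (simp add: powr_powr powr_half_sqrt)
  have "((\<gamma> i)\<^sup>2 * (w b)\<^sup>2) powr (p / 2) \<le> \<bar>\<gamma> i\<bar> powr p" for i
  proof -
    have "((\<gamma> i)\<^sup>2 * (w b)\<^sup>2) powr (p / 2) \<le> ((\<gamma> i)\<^sup>2) powr (p / 2)"
      using p w2 by (intro powr_mono2) (simp_all add: mult_left_le)
    also have "\<dots> = (\<bar>\<gamma> i\<bar> powr 2) powr (p / 2)"
      by simp
    also have "\<dots> = \<bar>\<gamma> i\<bar> powr p"
      by (simp only: powr_powr) simp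
    finally show ?thesis .
  qed
  then have 2: "(\<Sum>i\<in>A. ((\<gamma> i)\<^sup>2 * (w b)\<^sup>2) powr (p / 2)) powr (1 / p) \<le> Y powr (1 / p)"
    unfolding Y_def using p by (intro powr_mono2 sum_mono) (auto intro: sum_nonneg)
  have fin: "finite {b}" by simp
  have Max4: "Max {x1, x2, x3, x4} = max x4 x3" if "x1 \<le> x3" "x2 \<le> x4" for x1 x2 x3 x4 :: real
    using that by (auto simp: max_def)
  have "Xp_tensor_norm p w ?a = Max {sqrt (\<Sum>i\<in>A. (\<gamma> i)\<^sup>2 * (w i)\<^sup>2 * (w b)\<^sup>2),
      (\<Sum>i\<in>A. ((\<gamma> i)\<^sup>2 * (w b)\<^sup>2) powr (p / 2)) powr (1 / p), (X powr (p / 2)) powr (1 / p), Y powr (1 / p)}"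
    unfolding Xp_tensor_norm_eq_sum[OF A(1) fin a] X_def Y_def by simp
  also have "\<dots> = max (Y powr (1 / p)) (sqrt X)"
    unfolding 3 by (rule Max4[OF 1 2])
  finally show ?thesis
    unfolding Xp_norm_eq_sum[OF A] X_def Y_def .
qed

lemma Xp_tensor_norm_column:
  assumes p: "0 < p" and w: "0 \<le> w b" "w b \<le> 1" and g: "finsupp \<gamma>"
  shows "Xp_tensor_norm p w (\<lambda>(i, j). if i = b then \<gamma> j else 0) = Xp_norm p w \<gamma>"
proof -
  let ?a = "\<lambda>(i, j). if j = b then \<gamma> i else 0"
  have "{u. ?a u \<noteq> 0} \<subseteq> (\<lambda>i. (i, b)) ` {i. \<gamma> i \<noteq> 0}"
    by (auto split: if_splits)
  then have "finsupp ?a"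
    using g finite_surj unfolding finsupp_def by blast
  from Xp_tensor_norm_swap[OF this, of p w] show ?thesis
    using Xp_tensor_norm_row[of p w b, OF assms] by simp
qed

text \<open>Since \<open>p > 2\<close>, the \<open>p\<close>-th root of \<open>n\<close> is at most
  \<open>sqrt n\<close>, so sign sums over \<open>n\<close> unit vectors grow no faster than
  \<open>sqrt n\<close>. A bounded functional therefore cannot be large on many of them.\<close>

lemma Xp_norm_le_sqrt_card:
  assumes p: "2 < p" and w: "\<And>i. 0 \<le> w i \<and> w i \<le> 1" and F: "finite F"
    and g: "\<And>i. i \<notin> F \<Longrightarrow> \<gamma> i = 0" "\<And>i. \<bar>\<gamma> i\<bar> \<le> 1"
  shows "Xp_norm p w \<gamma> \<le> sqrt (card F)"
proof -
  have "(\<Sum>i\<in>F. \<bar>\<gamma> i\<bar> powr p) \<le> (\<Sum>i\<in>F. 1)"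
    using p g(2) by (intro sum_mono) (simp add: powr_le1)
  then have "(\<Sum>i\<in>F. \<bar>\<gamma> i\<bar> powr p) powr (1 / p) \<le> real (card F) powr (1 / p)"
    using p by (intro powr_mono2) (auto intro: sum_nonneg)
  also have "\<dots> \<le> real (card F) powr (1 / 2)"
    using p by (cases "card F = 0") (auto intro!: powr_mono simp: field_simps)
  also have "\<dots> = sqrt (card F)"
    by (simp add: powr_half_sqrt)
  finally have 1: "(\<Sum>i\<in>F. \<bar>\<gamma> i\<bar> powr p) powr (1 / p) \<le> sqrt (card F)" .
  have "(\<Sum>i\<in>F. (\<gamma> i)\<^sup>2 * (w i)\<^sup>2) \<le> (\<Sum>i\<in>F. 1)"
    using w g(2) by (intro sum_mono) (simp add: mult_le_one power_le_one abs_square_le_1)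
  then have 2: "sqrt (\<Sum>i\<in>F. (\<gamma> i)\<^sup>2 * (w i)\<^sup>2) \<le> sqrt (card F)"
    by (intro real_sqrt_le_mono) simp
  show ?thesis
    using 1 2 by (subst Xp_norm_eq_sum[OF F]) (use g(1) in auto)
qed

text \<open>The fourth term alone; it serves to bound how many coordinates of one vector can be
  large.\<close>

lemma powr_sum_le_Xp_tensor_norm:
  assumes p: "0 < p" and G: "finite G" and a: "\<And>u. u \<notin> G \<Longrightarrow> a u = 0"
  shows "(\<Sum>u\<in>G. \<bar>a u\<bar> powr p) powr (1 / p) \<le> Xp_tensor_norm p w a"
proof -
  have "(\<Sum>\<^sub>\<infinity>(i, j). \<bar>a (i, j)\<bar> powr p) = (\<Sum>\<^sub>\<infinity>u. \<bar>a u\<bar> powr p)"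
    by (rule infsum_cong) auto
  also have "\<dots> = (\<Sum>u\<in>G. \<bar>a u\<bar> powr p)"
    by (rule infsum_eq_sum[OF G]) (simp add: a)
  finally have "(\<Sum>u\<in>G. \<bar>a u\<bar> powr p) powr (1 / p) = (\<Sum>\<^sub>\<infinity>(i, j). \<bar>a (i, j)\<bar> powr p) powr (1 / p)"
    by simp
  also have "\<dots> \<le> Xp_tensor_norm p w a"
    unfolding Xp_tensor_norm_def by (rule Max_ge) auto
  finally show ?thesis .
qed

section \<open>Operators on the tensor product\<close>

text \<open>\<open>U \<circ> T\<close> maps \<open>Z\<close> into itself and differs from the
  identity there by at most 1/2, hence is invertible on \<open>Z\<close>. Applying its inverse after
  \<open>U\<close> gives a left inverse \<open>S\<close> of \<open>T\<close> on \<open>Z\<close>,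
  and \<open>T \<circ> S\<close> projects onto the image of \<open>Z\<close>.\<close>

lemma small_perturbation_invertible:
  fixes T U :: "'e::banach \<Rightarrow> 'e"
  assumes Z: "subspace Z" "closed Z" and T: "bounded_linear T" and U: "bounded_linear U" "range U \<subseteq> Z"
    and near: "\<And>z. z \<in> Z \<Longrightarrow> norm (U (T z) - z) \<le> norm z / 2"
  shows "isomorphism_into_on Z T" and "complemented (T ` Z)"
proof -
  interpret T: bounded_linear T by (rule T)
  interpret U: bounded_linear U by (rule U(1))
  have UZ: "U v \<in> Z" for v
    using U(2) by blast
  have unique: "\<exists>!z. z \<in> Z \<and> U (T z) = U v" for v
  proof -
    \<comment> \<open>The fixed points of this map are the solutions of
      \<open>U (T z) = U v\<close>. It preserves \<open>Z\<close> because
      \<open>range U \<subseteq> Z\<close>, and \<open>near\<close> applied to differences makes it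
      a contraction with factor 1/2.\<close>
    have "\<exists>!z\<in>Z. z - (U (T z) - U v) = z"
    proof (rule Banach_fix[of _ "1 / 2"])
      show "complete Z" "Z \<noteq> {}"
        using Z UZ by (auto simp: complete_eq_closed)
      show "(\<lambda>z. z - (U (T z) - U v)) ` Z \<subseteq> Z"
        using Z(1) UZ by (auto intro!: subspace_diff)
      fix x y assume "x \<in> Z" "y \<in> Z"
      then have "norm (U (T (x - y)) - (x - y)) \<le> norm (x - y) / 2"
        using Z(1) by (intro near subspace_diff)
      then show "dist (x - (U (T x) - U v)) (y - (U (T y) - U v)) \<le> 1 / 2 * dist x y"
        unfolding dist_norm by (subst norm_minus_commute) (simp add: T.diff U.diff algebra_simps)
    qed auto
    moreover have "z - (U (T z) - U v) = z \<longleftrightarrow> U (T z) = U v" for z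
      by auto
    ultimately show ?thesis
      by (simp only:)
  qed
  define S where "S v = (THE z. z \<in> Z \<and> U (T z) = U v)" for v
  have S: "S v \<in> Z" "U (T (S v)) = U v" for v
    using theI'[OF unique[of v]] by (simp_all add: S_def)
  have S_eq: "S v = z" if "z \<in> Z" "U (T z) = U v" for v z
    using unique[of v] S[of v] that by blast
  have ST: "S (T z) = z" if "z \<in> Z" for z
    using that by (intro S_eq) auto
  obtain B where B: "\<And>v. norm (U v) \<le> norm v * B"
    using U.bounded by blast
  have bl: "bounded_linear S"
  proof (rule bounded_linear_intro[where K = "2 * B"])
    show "S (u + v) = S u + S v" for u v
      by (rule S_eq) (use S Z(1) in \<open>auto simp: subspace_add T.add U.add\<close>)
    show "S (r *\<^sub>R v) = r *\<^sub>R S v" for r v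
      by (rule S_eq) (use S Z(1) in \<open>auto simp: subspace_scale T.scaleR U.scaleR\<close>)
    fix v
    \<comment> \<open>\<open>U v = U (T (S v))\<close> is within \<open>norm (S v) / 2\<close> of
      \<open>S v\<close>; absorbing that half gives the factor 2 in the bound.\<close>
    have "norm (S v) \<le> norm (U v) + norm (U v - S v)"
      using norm_triangle_ineq4[of "U v" "U v - S v"] by simp
    also have "\<dots> \<le> norm (U v) + norm (S v) / 2"
      using near[OF S(1)[of v]] S(2)[of v] by simp
    finally show "norm (S v) \<le> norm v * (2 * B)"
      using B[of v] by simp
  qed
  have "homeomorphism Z (T ` Z) T S"
    unfolding homeomorphism_def
    using ST by (auto simp: image_image intro!: linear_continuous_on T bl)
  then show "isomorphism_into_on Z T"
    unfolding isomorphism_into_on_def using Z(1) T by blast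
  have "bounded_linear (T \<circ> S)"
    unfolding comp_def by (rule bounded_linear_compose[OF T bl])
  moreover have "(T \<circ> S) \<circ> (T \<circ> S) = T \<circ> S"
    using ST S(1) by (auto simp: fun_eq_iff)
  moreover have "range (T \<circ> S) = T ` Z"
  proof
    show "range (T \<circ> S) \<subseteq> T ` Z"
      using S(1) by auto
    show "T ` Z \<subseteq> range (T \<circ> S)"
    proof
      fix v assume "v \<in> T ` Z"
      then have "v = (T \<circ> S) v"
        using ST by auto
      then show "v \<in> range (T \<circ> S)"
        by (rule range_eqI)
    qed
  qed
  ultimately show "complemented (T ` Z)"
    unfolding complemented_def by blast
qed

text \<open>Diagonal operators take values in \<open>'e\<close>, so an extension result beyond
  real-valued maps is called for. Linearity and the bound pass to the closure by continuity,
  additivity through the density of \<open>S \<times> S\<close>.\<close>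

lemma bounded_linear_extension_banach:
  fixes f :: "'e::real_normed_vector \<Rightarrow> 'f::banach"
  assumes S: "subspace S" "closure S = UNIV"
    and add: "\<And>u v. u \<in> S \<Longrightarrow> v \<in> S \<Longrightarrow> f (u + v) = f u + f v"
    and scale: "\<And>r u. u \<in> S \<Longrightarrow> f (r *\<^sub>R u) = r *\<^sub>R f u"
    and bd: "\<And>u. u \<in> S \<Longrightarrow> norm (f u) \<le> C * norm u"
  obtains g where "bounded_linear g" "\<And>u. u \<in> S \<Longrightarrow> g u = f u"
proof -
  have "\<bar>C\<bar>-lipschitz_on S f"
  proof (rule lipschitz_onI)
    fix u v assume uv: "u \<in> S" "v \<in> S"
    have "f u = f (u - v) + f v"
      using add[of "u - v" v] uv S(1) by (simp add: subspace_diff)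
    then have "dist (f u) (f v) = norm (f (u - v))"
      by (simp add: dist_norm)
    also have "\<dots> \<le> C * norm (u - v)"
      using uv S(1) by (intro bd) (simp add: subspace_diff)
    also have "\<dots> \<le> \<bar>C\<bar> * dist u v"
      by (simp add: dist_norm mult_right_mono)
    finally show "dist (f u) (f v) \<le> \<bar>C\<bar> * dist u v" .
  qed simp
  then obtain g where g: "uniformly_continuous_on (closure S) g" "\<And>u. u \<in> S \<Longrightarrow> f u = g u"
    using uniformly_continuous_on_extension_on_closure[OF lipschitz_on_uniformly_continuous]
    by metis
  have cont: "continuous_on UNIV g"
    using g(1) S(2) by (simp add: uniformly_continuous_imp_continuous)
  then have g_cont: "isCont g u" for u
    by (simp add: continuous_on_eq_continuous_at)
  have "bounded_linear g"
  proof (rule bounded_linear_intro[where K = C])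
    have dense: "closure (S \<times> S) = UNIV"
      using S(2) by (simp add: closure_Times)
    fix u v :: 'e
    have "continuous_on UNIV (\<lambda>z. g (fst z + snd z) - (g (fst z) + g (snd z)))"
      by (intro continuous_intros continuous_on_compose2[OF cont]) auto
    then have "g (fst (u, v) + snd (u, v)) - (g (fst (u, v)) + g (snd (u, v))) = 0"
      by (rule continuous_constant_on_closure[where S = "S \<times> S", unfolded dense])
        (use add S(1) in \<open>auto simp: subspace_add simp flip: g(2)\<close>)
    then show "g (u + v) = g u + g v"
      by simp
  next
    fix r and u :: 'e
    have "continuous_on UNIV (\<lambda>z. g (r *\<^sub>R z) - r *\<^sub>R g z)"
      by (intro continuous_intros continuous_on_compose2[OF cont]) auto
    then have "g (r *\<^sub>R u) - r *\<^sub>R g u = 0"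
      by (rule continuous_constant_on_closure[where S = S, unfolded S(2)])
        (use scale S(1) in \<open>auto simp: subspace_scale simp flip: g(2)\<close>)
    then show "g (r *\<^sub>R u) = r *\<^sub>R g u"
      by simp
  next
    fix u :: 'e
    have "continuous_on UNIV (\<lambda>z. norm (g z) - norm z * C)"
      by (intro continuous_intros cont)
    then have "norm (g u) - norm u * C \<le> 0"
      by (rule continuous_le_on_closure[where S = S, unfolded S(2)])
        (use bd in \<open>simp_all add: mult.commute flip: g(2)\<close>)
    then show "norm (g u) \<le> norm u * C"
      by simp
  qed
  then show ?thesis
    using g(2) that by metis
qed

section \<open>Coordinates, projections and diagonal operators for the tensor basis\<close>

locale Xp_tensor_space =
  fixes p :: real and w :: "'i \<Rightarrow> real" and E :: "'i \<times> 'i \<Rightarrow> 'e::banach" and c C :: real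
  assumes p: "2 < p" and w: "\<And>i. 0 < w i \<and> w i \<le> 1" and c: "0 < c" and C: "0 < C"
    and lower: "\<And>a. finsupp a \<Longrightarrow> c * Xp_tensor_norm p w a \<le> norm (lincomb E a)"
    and upper: "\<And>a. finsupp a \<Longrightarrow> norm (lincomb E a) \<le> C * Xp_tensor_norm p w a"
    and dense: "closure (span (range E)) = UNIV"
begin

abbreviation coord where "coord \<equiv> coord_functional E"

lemma is_coord: "is_coord_functional E u (coord u)"
proof -
  have "\<bar>a j\<bar> \<le> inverse c * norm (lincomb E a)" if "finsupp a" for a j
  proof -
    have "c * \<bar>a j\<bar> \<le> norm (lincomb E a)"
      using coord_le_Xp_tensor_norm[of p a j w] lower[OF that] c that p
      by (smt (verit) mult_left_mono)
    then show ?thesis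
      using c by (simp add: field_simps)
  qed
  from coord_functional_exists[OF dense this] show ?thesis
    unfolding coord_functional_def by (rule theI')
qed

lemma coord_linear: "bounded_linear (coord u)"
  and coord_basis: "coord u (E v) = (if v = u then 1 else 0)"
  using is_coord[of u] unfolding is_coord_functional_def by blast+

lemma coord_sum:
  assumes "finite F"
  shows "coord u (\<Sum>v\<in>F. g v *\<^sub>R E v) = (if u \<in> F then g u else 0)"
proof -
  interpret bounded_linear "coord u" by (rule coord_linear)
  show ?thesis
    using assms by (simp add: sum scaleR coord_basis if_distrib[of "\<lambda>x. _ * x"] sum.delta cong: if_cong)
qed

definition restr :: "('i \<times> 'i) set \<Rightarrow> ('i \<times> 'i \<Rightarrow> real) \<Rightarrow> 'i \<times> 'i \<Rightarrow> real" where
  "restr F g u = (if u \<in> F then g u else 0)"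

lemma finsupp_restr: "finite F \<Longrightarrow> finsupp (restr F g)"
  unfolding finsupp_def restr_def by (rule finite_subset[of _ F]) auto

lemma lincomb_restr: "finite F \<Longrightarrow> lincomb E (restr F g) = (\<Sum>v\<in>F. g v *\<^sub>R E v)"
  by (subst lincomb_superset[of F]) (auto simp: restr_def)

lemma norm_sum_upper: "finite F \<Longrightarrow> norm (\<Sum>v\<in>F. g v *\<^sub>R E v) \<le> C * Xp_tensor_norm p w (restr F g)"
  using upper[OF finsupp_restr] by (simp add: lincomb_restr)

lemma norm_sum_lower: "finite F \<Longrightarrow> c * Xp_tensor_norm p w (restr F g) \<le> norm (\<Sum>v\<in>F. g v *\<^sub>R E v)"
  using lower[OF finsupp_restr] by (simp add: lincomb_restr)

text \<open>Unconditionality transferred to \<open>'e\<close>: passing to the model norm costs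
  \<open>C\<close> and coming back costs \<open>1 / c\<close>.\<close>

lemma norm_multiplier_le:
  assumes F: "finite F" and L: "0 \<le> L" and le: "\<And>v. v \<in> F \<Longrightarrow> \<bar>g' v\<bar> \<le> L * \<bar>g v\<bar>"
  shows "norm (\<Sum>v\<in>F. g' v *\<^sub>R E v) \<le> C / c * L * norm (\<Sum>v\<in>F. g v *\<^sub>R E v)"
proof -
  have "norm (\<Sum>v\<in>F. g' v *\<^sub>R E v) \<le> C * Xp_tensor_norm p w (restr F g')"
    by (rule norm_sum_upper[OF F])
  also have "\<dots> \<le> C * (L * Xp_tensor_norm p w (restr F g))"
    using C p L le by (intro mult_left_mono Xp_tensor_norm_mono finsupp_restr F) (auto simp: restr_def)
  also have "\<dots> = C / c * L * (c * Xp_tensor_norm p w (restr F g))"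
    using c by simp
  also have "\<dots> \<le> C / c * L * norm (\<Sum>v\<in>F. g v *\<^sub>R E v)"
    using C c L by (intro mult_left_mono norm_sum_lower F) auto
  finally show ?thesis .
qed

text \<open>For infinite \<open>G\<close> the sum is 0, so \<open>proj G\<close> is bounded and
  linear for every \<open>G\<close>.\<close>

definition proj :: "('i \<times> 'i) set \<Rightarrow> 'e \<Rightarrow> 'e" where
  "proj G z = (\<Sum>v\<in>G. coord v z *\<^sub>R E v)"

lemma proj_linear: "bounded_linear (proj G)"
  unfolding proj_def by (intro bounded_linear_sum bounded_linear_scaleR_const coord_linear)

lemma proj_eventually_id:
  assumes "z \<in> span (range E)"
  obtains F where "finite F" "\<And>G. finite G \<Longrightarrow> F \<subseteq> G \<Longrightarrow> proj G z = z"
proof -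
  interpret P: bounded_linear "proj G" for G by (rule proj_linear)
  have "\<exists>F. finite F \<and> (\<forall>G. finite G \<longrightarrow> F \<subseteq> G \<longrightarrow> proj G z = z)"
    using assms
  proof (induction rule: span_induct_alt)
    case base
    then show ?case by (auto simp: P.zero)
  next
    case (step r x y)
    then obtain F u where "finite F" "\<And>G. finite G \<Longrightarrow> F \<subseteq> G \<Longrightarrow> proj G y = y" "x = E u"
      by blast
    moreover have "proj G (E u) = E u" if "finite G" "u \<in> G" for G
    proof -
      have "proj G (E u) = (\<Sum>v\<in>G. if v = u then E u else 0)"
        unfolding proj_def by (rule sum.cong) (auto simp: coord_basis)
      then show ?thesis
        using that by simp
    qed
    ultimately show ?case
      by (intro exI[of _ "insert u F"]) (auto simp: P.add P.scaleR)
  qed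
  then show ?thesis
    using that by blast
qed

text \<open>On the span, \<open>z\<close> is a finite sum over \<open>F \<union> G\<close> to which
  \<open>proj G\<close> applies a multiplier with values 0 and 1, so the bound does not depend on
  \<open>G\<close>. Density does the rest.\<close>

lemma norm_proj_le:
  assumes G: "finite G"
  shows "norm (proj G z) \<le> C / c * norm z"
proof -
  interpret P: bounded_linear "proj G" by (rule proj_linear)
  have "continuous_on UNIV (\<lambda>z. norm (proj G z) - C / c * norm z)"
    by (intro continuous_intros P.continuous_on)
  then have "norm (proj G z) - C / c * norm z \<le> 0"
  proof (rule continuous_le_on_closure[where S = "span (range E)", unfolded dense])
    fix z assume "z \<in> span (range E)"
    then obtain F where F: "finite F" "\<And>G. finite G \<Longrightarrow> F \<subseteq> G \<Longrightarrow> proj G z = z"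
      using proj_eventually_id by metis
    have fin: "finite (F \<union> G)"
      using F(1) G by simp
    have "proj G z = (\<Sum>v\<in>F \<union> G. (if v \<in> G then coord v z else 0) *\<^sub>R E v)"
      unfolding proj_def by (rule sum.mono_neutral_cong_left) (use fin in auto)
    also have "norm \<dots> \<le> C / c * 1 * norm (\<Sum>v\<in>F \<union> G. coord v z *\<^sub>R E v)"
      by (rule norm_multiplier_le[OF fin]) auto
    also have "(\<Sum>v\<in>F \<union> G. coord v z *\<^sub>R E v) = z"
      using F(2)[OF fin] by (simp add: proj_def)
    finally show "norm (proj G z) - C / c * norm z \<le> 0"
      by simp
  qed simp
  then show ?thesis
    by simp
qed

text \<open>Gives coefficient bounds for vectors that need not be finite combinations, such as
  images under an operator.\<close>

lemma Xp_tensor_norm_coords_le: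
  assumes G: "finite G"
  shows "c * Xp_tensor_norm p w (restr G (\<lambda>v. coord v z)) \<le> C / c * norm z"
  using norm_sum_lower[OF G, of "\<lambda>v. coord v z"] norm_proj_le[OF G, of z] by (simp add: proj_def)

text \<open>On the span the diagonal operator is a finite sum, bounded by unconditionality; density
  extends both the operator and its action on coordinates.\<close>

lemma multiplier_exists:
  assumes L: "\<And>v. \<bar>m v\<bar> \<le> L"
  obtains U where "bounded_linear U" "\<And>v. U (E v) = m v *\<^sub>R E v" "\<And>v z. coord v (U z) = m v * coord v z"
proof -
  \<comment> \<open>Any index serves; \<open>undefined\<close> only provides one.\<close>
  have L0: "0 \<le> L"
    using L[of undefined] by linarith
  define D where "D G z = (\<Sum>v\<in>G. (m v * coord v z) *\<^sub>R E v)" for G z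
  have D_linear: "bounded_linear (D G)" for G
    unfolding D_def
    by (intro bounded_linear_sum bounded_linear_scaleR_const bounded_linear_const_mult coord_linear)
  interpret D: bounded_linear "D G" for G by (rule D_linear)
  define f where "f z = D {v. coord v z \<noteq> 0} z" for z
  \<comment> \<open>The filter of finite sets lets several vectors share one finite
    \<open>G\<close>, on which \<open>f\<close> agrees with the linear map \<open>D G\<close>;
    additivity and homogeneity of \<open>f\<close> follow.\<close>
  have f: "eventually (\<lambda>G. finite G \<and> f z = D G z \<and> proj G z = z) (finite_subsets_at_top UNIV)" if z: "z \<in> span (range E)" for z
  proof -
    obtain F where F: "finite F" "\<And>G. finite G \<Longrightarrow> F \<subseteq> G \<Longrightarrow> proj G z = z"
      using proj_eventually_id[OF z] by metis
    have "coord v z = 0" if "v \<notin> F" for v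
      using coord_sum[OF F(1), of v "\<lambda>v. coord v z"] F that by (simp add: proj_def)
    then have "{v. coord v z \<noteq> 0} \<subseteq> F"
      by blast
    then have "f z = D G z" if "finite G" "F \<subseteq> G" for G
      unfolding f_def D_def by (rule_tac sum.mono_neutral_left) (use that in auto)
    then show ?thesis
      unfolding eventually_finite_subsets_at_top using F by (intro exI[of _ F]) blast
  qed
  have sub: "subspace (span (range E))"
    by (rule subspace_span)
  obtain U where U: "bounded_linear U" "\<And>u. u \<in> span (range E) \<Longrightarrow> U u = f u"
  proof (rule bounded_linear_extension_banach[OF sub dense, of f "C / c * L"])
    fix u v assume uv: "u \<in> span (range E)" "v \<in> span (range E)"
    have "eventually (\<lambda>_. f (u + v) = f u + f v) (finite_subsets_at_top (UNIV :: ('i \<times> 'i) set))"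
      using f[OF uv(1)] f[OF uv(2)] f[OF span_add[OF uv]] by eventually_elim (simp add: D.add)
    then show "f (u + v) = f u + f v"
      by simp
  next
    fix r u assume u: "u \<in> span (range E)"
    have "eventually (\<lambda>_. f (r *\<^sub>R u) = r *\<^sub>R f u) (finite_subsets_at_top (UNIV :: ('i \<times> 'i) set))"
      using f[OF u] f[OF span_scale[OF u, of r]] by eventually_elim (simp add: D.scaleR)
    then show "f (r *\<^sub>R u) = r *\<^sub>R f u"
      by simp
  next
    fix u assume "u \<in> span (range E)"
    from eventually_happens'[OF finite_subsets_at_top_neq_bot f[OF this]]
    obtain F where F: "finite F" "f u = D F u" "proj F u = u"
      by blast
    have "norm (D F u) \<le> C / c * L * norm (\<Sum>v\<in>F. coord v u *\<^sub>R E v)"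
      unfolding D_def using L
      by (intro norm_multiplier_le F L0) (auto simp: abs_mult mult_right_mono)
    then show "norm (f u) \<le> C / c * L * norm u"
      using F by (simp add: proj_def)
  qed (use that in blast)
  interpret U: bounded_linear U by (rule U(1))
  have UE: "U (E v) = m v *\<^sub>R E v" for v
  proof -
    have "U (E v) = f (E v)"
      by (intro U(2) span_base) simp
    also have "\<dots> = m v *\<^sub>R E v"
      by (simp add: f_def D_def coord_basis)
    finally show ?thesis .
  qed
  moreover have "coord v (U z) = m v * coord v z" for v z
  proof -
    interpret cv: bounded_linear "coord v" by (rule coord_linear)
    have "coord v (U z) - m v * coord v z = 0" if "z \<in> span (range E)" for z
      using that
      by (induction rule: span_induct_alt)
        (auto simp: U.zero cv.zero U.add U.scaleR cv.add cv.scaleR UE coord_basis algebra_simps split: if_splits)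
    moreover have "continuous_on UNIV (\<lambda>z. coord v (U z) - m v * coord v z)"
      by (intro continuous_intros cv.continuous_on U.continuous_on)
    ultimately have "coord v (U z) - m v * coord v z = 0"
      using continuous_constant_on_closure[where S = "span (range E)", unfolded dense] by blast
    then show ?thesis
      by simp
  qed
  ultimately show ?thesis
    using that U(1) by blast
qed

section \<open>Rows and columns of the tensor product\<close>

lemma norm_row_le:
  assumes F: "finite F" and a: "inj_on a F"
  shows "norm (\<Sum>i\<in>F. g i *\<^sub>R E (a i, b)) \<le> C * Xp_norm p w (\<lambda>u. if u \<in> a ` F then g (the_inv_into F a u) else 0)"
    (is "_ \<le> C * Xp_norm p w ?\<gamma>")
proof -
  let ?g = "\<lambda>u. g (the_inv_into F a (fst u))"
  let ?G = "(\<lambda>i. (a i, b)) ` F"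
  have inj: "inj_on (\<lambda>i. (a i, b)) F"
    using a by (auto simp: inj_on_def)
  have "(\<Sum>i\<in>F. g i *\<^sub>R E (a i, b)) = (\<Sum>v\<in>?G. ?g v *\<^sub>R E v)"
    by (subst sum.reindex[OF inj]) (auto intro!: sum.cong simp: the_inv_into_f_f[OF a])
  also have "norm \<dots> \<le> C * Xp_tensor_norm p w (restr ?G ?g)"
    by (rule norm_sum_upper) (use F in simp)
  also have "restr ?G ?g = (\<lambda>(i, j). if j = b then ?\<gamma> i else 0)"
    by (auto simp: restr_def fun_eq_iff)
  also have "Xp_tensor_norm p w \<dots> = Xp_norm p w ?\<gamma>"
    using p w[of b] F
    by (intro Xp_tensor_norm_row) (auto simp: finsupp_def intro: finite_subset[of _ "a ` F"])
  finally show ?thesis .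
qed

lemma norm_column_le:
  assumes F: "finite F" and a: "inj_on a F"
  shows "norm (\<Sum>i\<in>F. g i *\<^sub>R E (b, a i)) \<le> C * Xp_norm p w (\<lambda>u. if u \<in> a ` F then g (the_inv_into F a u) else 0)"
    (is "_ \<le> C * Xp_norm p w ?\<gamma>")
proof -
  let ?g = "\<lambda>u. g (the_inv_into F a (snd u))"
  let ?G = "(\<lambda>i. (b, a i)) ` F"
  have inj: "inj_on (\<lambda>i. (b, a i)) F"
    using a by (auto simp: inj_on_def)
  have "(\<Sum>i\<in>F. g i *\<^sub>R E (b, a i)) = (\<Sum>v\<in>?G. ?g v *\<^sub>R E v)"
    by (subst sum.reindex[OF inj]) (auto intro!: sum.cong simp: the_inv_into_f_f[OF a])
  also have "norm \<dots> \<le> C * Xp_tensor_norm p w (restr ?G ?g)"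
    by (rule norm_sum_upper) (use F in simp)
  also have "restr ?G ?g = (\<lambda>(i, j). if i = b then ?\<gamma> j else 0)"
    by (auto simp: restr_def fun_eq_iff)
  also have "Xp_tensor_norm p w \<dots> = Xp_norm p w ?\<gamma>"
    using p w[of b] F
    by (intro Xp_tensor_norm_column) (auto simp: finsupp_def intro: finite_subset[of _ "a ` F"])
  finally show ?thesis .
qed

text \<open>
  The norm of a row does not depend on which second coordinate carries it, because the weights are
  at most \<open>1\<close>. So moving one row to another costs only the size of the multiplying coefficients.
\<close>

lemma norm_row_shift:
  assumes F: "finite F" and a: "inj_on a F" and G: "finite G" "(\<lambda>i. (a i, b')) ` F \<subseteq> G"
    and L: "0 \<le> L" and le: "\<And>i. i \<in> F \<Longrightarrow> \<bar>g i\<bar> \<le> L * \<bar>h (a i, b')\<bar>"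
  shows "norm (\<Sum>i\<in>F. g i *\<^sub>R E (a i, b)) \<le> C / c * L * norm (\<Sum>v\<in>G. h v *\<^sub>R E v)"
proof -
  let ?\<gamma> = "\<lambda>u. if u \<in> a ` F then g (the_inv_into F a u) else 0"
  have "norm (\<Sum>i\<in>F. g i *\<^sub>R E (a i, b)) \<le> C * Xp_norm p w ?\<gamma>"
    by (rule norm_row_le[OF F a])
  also have "Xp_norm p w ?\<gamma> = Xp_tensor_norm p w (\<lambda>(i, j). if j = b' then ?\<gamma> i else 0)"
    using p w[of b'] F
    by (intro Xp_tensor_norm_row[symmetric]) (auto simp: finsupp_def intro: finite_subset[of _ "a ` F"])
  also have "\<dots> \<le> L * Xp_tensor_norm p w (restr G h)"
  proof (rule Xp_tensor_norm_mono[OF _ finsupp_restr[OF G(1)] L])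
    fix u :: "'i \<times> 'i"
    obtain i j where u: "u = (i, j)"
      by force
    show "\<bar>case u of (i, j) \<Rightarrow> if j = b' then ?\<gamma> i else 0\<bar> \<le> L * \<bar>restr G h u\<bar>"
    proof (cases "j = b' \<and> i \<in> a ` F")
      case True
      then obtain k where "k \<in> F" "u = (a k, b')" "i = a k"
        using u by auto
      then show ?thesis
        using le[of k] G(2) True by (auto simp: restr_def the_inv_into_f_f[OF a])
    next
      case False
      then show ?thesis
        using L by (auto simp: u restr_def)
    qed
  qed (use p in simp)
  also have "C * (L * Xp_tensor_norm p w (restr G h)) = C / c * L * (c * Xp_tensor_norm p w (restr G h))"
    using c by simp
  also have "\<dots> \<le> C / c * L * norm (\<Sum>v\<in>G. h v *\<^sub>R E v)"
    using C c L by (intro mult_left_mono norm_sum_lower G) auto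
  finally show ?thesis
    using C by (simp add: mult_left_mono)
qed

text \<open>The transpose of \<open>norm_row_shift\<close>, resting on
  \<open>Xp_tensor_norm_column\<close>; it treats the entries that keep the second
  coordinate.\<close>

lemma norm_column_shift:
  assumes F: "finite F" and a: "inj_on a F" and G: "finite G" "(\<lambda>i. (b', a i)) ` F \<subseteq> G"
    and L: "0 \<le> L" and le: "\<And>i. i \<in> F \<Longrightarrow> \<bar>g i\<bar> \<le> L * \<bar>h (b', a i)\<bar>"
  shows "norm (\<Sum>i\<in>F. g i *\<^sub>R E (b, a i)) \<le> C / c * L * norm (\<Sum>v\<in>G. h v *\<^sub>R E v)"
proof -
  let ?\<gamma> = "\<lambda>u. if u \<in> a ` F then g (the_inv_into F a u) else 0"
  have "norm (\<Sum>i\<in>F. g i *\<^sub>R E (b, a i)) \<le> C * Xp_norm p w ?\<gamma>"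
    by (rule norm_column_le[OF F a])
  also have "Xp_norm p w ?\<gamma> = Xp_tensor_norm p w (\<lambda>(i, j). if i = b' then ?\<gamma> j else 0)"
    using p w[of b'] F
    by (intro Xp_tensor_norm_column[symmetric]) (auto simp: finsupp_def intro: finite_subset[of _ "a ` F"])
  also have "\<dots> \<le> L * Xp_tensor_norm p w (restr G h)"
  proof (rule Xp_tensor_norm_mono[OF _ finsupp_restr[OF G(1)] L])
    fix u :: "'i \<times> 'i"
    obtain j i where u: "u = (j, i)"
      by force
    show "\<bar>case u of (i, j) \<Rightarrow> if i = b' then ?\<gamma> j else 0\<bar> \<le> L * \<bar>restr G h u\<bar>"
    proof (cases "j = b' \<and> i \<in> a ` F")
      case True
      then obtain k where "k \<in> F" "u = (b', a k)" "i = a k"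
        using u by auto
      then show ?thesis
        using le[of k] G(2) True by (auto simp: restr_def the_inv_into_f_f[OF a])
    next
      case False
      then show ?thesis
        using L by (auto simp: u restr_def)
    qed
  qed (use p in simp)
  also have "C * (L * Xp_tensor_norm p w (restr G h)) = C / c * L * (c * Xp_tensor_norm p w (restr G h))"
    using c by simp
  also have "\<dots> \<le> C / c * L * norm (\<Sum>v\<in>G. h v *\<^sub>R E v)"
    using C c L by (intro mult_left_mono norm_sum_lower G) auto
  finally show ?thesis
    using C by (simp add: mult_left_mono)
qed

lemma Xp_norm_image_le_sqrt_card:
  assumes F: "finite F" and a: "inj_on a F" and g: "\<And>i. \<bar>g i\<bar> \<le> 1"
  shows "Xp_norm p w (\<lambda>u. if u \<in> a ` F then g (the_inv_into F a u) else 0) \<le> sqrt (card F)"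
proof -
  have "Xp_norm p w (\<lambda>u. if u \<in> a ` F then g (the_inv_into F a u) else 0) \<le> sqrt (card (a ` F))"
    by (rule Xp_norm_le_sqrt_card) (use p w F g in \<open>auto intro: less_imp_le\<close>)
  then show ?thesis
    by (simp add: card_image[OF a])
qed

lemma norm_basis_le: "norm (E u) \<le> C"
proof -
  obtain i j where u: "u = (i, j)"
    by force
  have "norm (\<Sum>k\<in>{i}. 1 *\<^sub>R E (k, j)) \<le> C * sqrt (card {i})"
    by (rule order_trans[OF norm_row_le mult_left_mono[OF Xp_norm_image_le_sqrt_card]]) (use C in auto)
  then show ?thesis
    by (simp add: u)
qed

end

section \<open>Selection of rich sets\<close>

declare split_paired_All [simp del] split_paired_Ex [simp del]

text \<open>
  Unlike convergence to \<open>0\<close>, a uniform bound on the number of large entries survives pointwise limits.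
\<close>

definition thin :: "(real \<Rightarrow> real) \<Rightarrow> (nat \<Rightarrow> real) \<Rightarrow> bool" where
  "thin B f \<longleftrightarrow> (\<forall>\<delta>>0. \<forall>F. finite F \<longrightarrow> (\<forall>k\<in>F. \<delta> < \<bar>f k\<bar>) \<longrightarrow> real (card F) \<le> B \<delta>)"

lemma thin_tendsto_0:
  assumes "thin B f"
  shows "f \<longlonglongrightarrow> 0"
proof (rule tendstoI)
  fix \<delta> :: real assume "0 < \<delta>"
  \<comment> \<open>All finite sets of large indices obey the same cardinality bound, which forces
    the set of all large indices to be finite. The half leaves room for the strict inequality at the
    end.\<close>
  have "finite {k. \<delta> / 2 < \<bar>f k\<bar>}"
  proof (rule finite_if_finite_subsets_card_bdd[THEN conjunct1])
    fix F assume F: "F \<subseteq> {k. \<delta> / 2 < \<bar>f k\<bar>}" "finite F"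
    then have "real (card F) \<le> B (\<delta> / 2)"
      using assms[unfolded thin_def, rule_format, of "\<delta> / 2" F] \<open>0 < \<delta>\<close> by auto
    then show "card F \<le> nat \<lceil>B (\<delta> / 2)\<rceil>"
      by linarith
  qed
  then have "eventually (\<lambda>k. \<not> \<delta> / 2 < \<bar>f k\<bar>) sequentially"
    by (simp add: cofinite_eq_sequentially[symmetric] eventually_cofinite)
  then show "eventually (\<lambda>k. dist (f k) 0 < \<delta>) sequentially"
    by eventually_elim (use \<open>0 < \<delta>\<close> in auto)
qed

text \<open>Exceeding \<open>\<delta>\<close> at finitely many places is an open condition, so it
  already holds for some \<open>g x\<close>, whose bound then applies.\<close>

lemma thin_limit:
  assumes "\<Phi> \<noteq> bot" and "\<And>x. thin B (g x)" and "\<And>k. ((\<lambda>x. g x k) \<longlongrightarrow> f k) \<Phi>"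
  shows "thin B f"
  unfolding thin_def
proof (intro allI impI)
  fix \<delta> :: real and F :: "nat set"
  assume "0 < \<delta>" "finite F" "\<forall>k\<in>F. \<delta> < \<bar>f k\<bar>"
  then have "\<forall>k\<in>F. eventually (\<lambda>x. \<delta> < \<bar>g x k\<bar>) \<Phi>"
    using order_tendstoD(1)[OF tendsto_rabs[OF assms(3)]] by blast
  then have "eventually (\<lambda>x. \<forall>k\<in>F. \<delta> < \<bar>g x k\<bar>) \<Phi>"
    by (simp add: eventually_ball_finite \<open>finite F\<close>)
  then obtain x where "\<forall>k\<in>F. \<delta> < \<bar>g x k\<bar>"
    using assms(1) eventually_happens' by blast
  then show "real (card F) \<le> B \<delta>"
    using assms(2)[of x] \<open>0 < \<delta>\<close> \<open>finite F\<close> by (simp add: thin_def)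
qed

text \<open>Diagonal extraction, available because the index type is countable.\<close>

lemma pointwise_convergent_subsequence:
  fixes g :: "nat \<Rightarrow> 'b::countable \<Rightarrow> real"
  assumes "\<And>k x. \<bar>g k x\<bar> \<le> R"
  obtains r l where "strict_mono (r :: nat \<Rightarrow> nat)" "\<And>x. (\<lambda>k. g (r k) x) \<longlonglongrightarrow> l x"
proof -
  obtain r where "strict_mono (r :: nat \<Rightarrow> nat)" "\<And>x. \<exists>l. (\<lambda>k. g (r k) x) \<longlonglongrightarrow> l"
    using function_convergent_subsequence[of UNIV g R] assms by auto
  then show ?thesis
    using that by metis
qed

section \<open>Limits of a coefficient matrix along the columns of the index set\<close>

type_synonym matrix4 = "nat \<times> nat \<Rightarrow> nat \<times> nat \<Rightarrow> nat \<times> nat \<Rightarrow> nat \<times> nat \<Rightarrow> real"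

definition column :: "nat \<Rightarrow> (nat \<times> nat) filter" where
  "column n = filtermap (Pair n) sequentially"

definition columns_null :: "(nat \<times> nat \<Rightarrow> nat \<times> nat \<Rightarrow> real) \<Rightarrow> bool" where
  "columns_null \<tau> \<longleftrightarrow>
     (\<forall>n c. ((\<lambda>a. \<tau> a c) \<longlongrightarrow> 0) (column n) \<and> ((\<lambda>a. \<tau> c a) \<longlongrightarrow> 0) (column n))"

definition columns_thin :: "(real \<Rightarrow> real) \<Rightarrow> (nat \<times> nat \<Rightarrow> nat \<times> nat \<Rightarrow> real) \<Rightarrow> bool" where
  "columns_thin B \<tau> \<longleftrightarrow> (\<forall>n c. thin B (\<lambda>k. \<tau> (n, k) c) \<and> thin B (\<lambda>k. \<tau> c (n, k)))"

lemma columns_thin_null: "columns_thin B \<tau> \<Longrightarrow> columns_null \<tau>"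
  by (auto simp: columns_thin_def columns_null_def column_def filterlim_filtermap
      intro: thin_tendsto_0)

lemma columns_thin_limit:
  assumes "\<Phi> \<noteq> bot" and "\<And>x. columns_thin B (g x)"
    and "\<And>a b. ((\<lambda>x. g x a b) \<longlongrightarrow> f a b) \<Phi>"
  shows "columns_thin B f"
  unfolding columns_thin_def
proof (intro allI conjI)
  fix n c
  show "thin B (\<lambda>k. f (n, k) c)"
    by (rule thin_limit[where g = "\<lambda>x k. g x (n, k) c", OF assms(1)])
      (use assms(2,3) in \<open>unfold columns_thin_def, blast+\<close>)
  show "thin B (\<lambda>k. f c (n, k))"
    by (rule thin_limit[where g = "\<lambda>x k. g x c (n, k)", OF assms(1)])
      (use assms(2,3) in \<open>unfold columns_thin_def, blast+\<close>)
qed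

lemma column_fst: "eventually (\<lambda>a. fst a = n) (column n)"
  by (simp add: column_def eventually_filtermap)

lemma column_neq: "eventually (\<lambda>a. c \<noteq> a) (column n)"
  unfolding column_def eventually_filtermap
  by (rule eventually_mono[OF eventually_gt_at_top[of "snd c"]]) (metis less_irrefl snd_conv)

text \<open>Filters stand for subsequences: \<open>\<Phi> n\<close> refines the approach to infinity
  inside column \<open>n\<close>, and \<open>\<Psi>\<close> that of \<open>n\<close> itself. Each
  requirement of the selection becomes an \<open>eventually\<close> statement, and finitely many of
  them can be met at once.\<close>

definition iterated_limit ::
  "matrix4 \<Rightarrow> (nat \<Rightarrow> (nat \<times> nat) filter) \<Rightarrow> nat filter \<Rightarrow>
    (nat \<Rightarrow> nat \<times> nat \<Rightarrow> nat \<times> nat \<Rightarrow> real) \<Rightarrow> (nat \<times> nat \<Rightarrow> nat \<times> nat \<Rightarrow> real) \<Rightarrow> bool" where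
  "iterated_limit t \<Phi> \<Psi> s S \<longleftrightarrow>
     (\<forall>n. \<Phi> n \<noteq> bot \<and> \<Phi> n \<le> column n) \<and> \<Psi> \<noteq> bot \<and> \<Psi> \<le> sequentially \<and>
     (\<forall>n b c. ((\<lambda>a. t a b a c) \<longlongrightarrow> s n b c) (\<Phi> n)) \<and>
     (\<forall>b c. ((\<lambda>n. s n b c) \<longlongrightarrow> S b c) \<Psi>)"

text \<open>One extraction inside every column, then one over the columns. The common bound
  \<open>B\<close> survives both limits, and only afterwards is it turned into null columns.\<close>

lemma iterated_limit_exists:
  assumes bd: "\<And>a b c. \<bar>t a b a c\<bar> \<le> R"
    and thin: "\<And>a. columns_thin B (\<lambda>b c. t a b a c)"
  obtains \<Phi> \<Psi> s S where "iterated_limit t \<Phi> \<Psi> s S" "\<And>n. columns_null (s n)" "columns_null S"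
proof -
  have "\<exists>r l. strict_mono (r :: nat \<Rightarrow> nat) \<and> (\<forall>z. (\<lambda>k. t (n, r k) (fst z) (n, r k) (snd z)) \<longlonglongrightarrow> l z)"
    for n
    by (rule pointwise_convergent_subsequence[of "\<lambda>k z. t (n, k) (fst z) (n, k) (snd z)" R])
      (use bd in blast)+
  then have "\<forall>n. \<exists>r l. strict_mono (r :: nat \<Rightarrow> nat) \<and> (\<forall>z. (\<lambda>k. t (n, r k) (fst z) (n, r k) (snd z)) \<longlonglongrightarrow> l z)"
    by blast
  from choice[OF this] obtain r where "\<forall>n. \<exists>l. strict_mono (r n :: nat \<Rightarrow> nat) \<and>
      (\<forall>z. (\<lambda>k. t (n, r n k) (fst z) (n, r n k) (snd z)) \<longlonglongrightarrow> l z)"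
    by blast
  from choice[OF this] obtain l where r: "\<And>n. strict_mono (r n :: nat \<Rightarrow> nat)"
    and l: "\<And>n z. (\<lambda>k. t (n, r n k) (fst z) (n, r n k) (snd z)) \<longlonglongrightarrow> l n z"
    by blast
  \<comment> \<open>The limits keep the bound of the entries, so the second extraction applies to
    them.\<close>
  have "\<bar>l n z\<bar> \<le> R" for n z
    by (rule tendsto_le[OF _ tendsto_const tendsto_rabs[OF l]]) (use bd in auto)
  then obtain \<rho> L where \<rho>: "strict_mono (\<rho> :: nat \<Rightarrow> nat)" and L: "\<And>z. (\<lambda>k. l (\<rho> k) z) \<longlonglongrightarrow> L z"
    using pointwise_convergent_subsequence[of l R] by metis
  define \<Phi> where "\<Phi> n = filtermap (\<lambda>k. (n, r n k)) sequentially" for n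
  define \<Psi> where "\<Psi> = filtermap \<rho> sequentially"
  define s where "s n b c = l n (b, c)" for n b c
  define S where "S b c = L (b, c)" for b c
  have \<Phi>: "((\<lambda>a. t a b a c) \<longlongrightarrow> s n b c) (\<Phi> n)" for n b c
    using l[of n "(b, c)"] by (simp add: \<Phi>_def s_def filterlim_filtermap)
  have \<Psi>: "((\<lambda>n. s n b c) \<longlongrightarrow> S b c) \<Psi>" for b c
    using L[of "(b, c)"] by (simp add: \<Psi>_def s_def S_def filterlim_filtermap)
  have \<Phi>0: "\<Phi> n \<noteq> bot" "\<Psi> \<noteq> bot" for n
    by (simp_all add: \<Phi>_def \<Psi>_def filtermap_bot_iff)
  have "\<Phi> n = filtermap (Pair n) (filtermap (r n) sequentially)" for n
    by (simp add: \<Phi>_def filtermap_filtermap)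
  then have "\<Phi> n \<le> column n" for n
    using filterlim_subseq[OF r[of n]] by (simp add: column_def filtermap_mono filterlim_def)
  moreover have "\<Psi> \<le> sequentially"
    using filterlim_subseq[OF \<rho>] by (simp add: \<Psi>_def filterlim_def)
  ultimately have "iterated_limit t \<Phi> \<Psi> s S"
    using \<Phi>0 \<Phi> \<Psi> by (simp add: iterated_limit_def)
  moreover have *: "columns_thin B (s n)" for n
    by (rule columns_thin_limit[where g = "\<lambda>a b c. t a b a c", OF \<Phi>0(1) thin \<Phi>])
  moreover have "columns_thin B S"
    by (rule columns_thin_limit[where g = s, OF \<Phi>0(2) * \<Psi>])
  ultimately show ?thesis
    using that columns_thin_null by blast
qed

section \<open>Inductive choice of the indices in both factors\<close>

abbreviation (input) flip :: "matrix4 \<Rightarrow> matrix4" where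
  "flip t \<equiv> (\<lambda>b a b' a'. t a b a' b')"

text \<open>A summable error budget: over all \<open>i\<close> and \<open>j\<close> it totals
  \<open>4 * \<eta>\<close>, and the nested form \<open>dev (dev \<eta> i i') j j'\<close> totals
  \<open>16 * \<eta>\<close>.\<close>

abbreviation (input) dev :: "real \<Rightarrow> nat \<Rightarrow> nat \<Rightarrow> real" where
  "dev \<eta> i j \<equiv> \<eta> * (1 / 2) ^ i * (1 / 2) ^ j"

text \<open>
  Rows \<open>a i\<close> are chosen from the columns \<open>\<nu> (fst (prod_decode i))\<close>, a schedule that returns to every
  \<open>\<nu> m\<close> infinitely often. A limit \<open>s n b c\<close> does not change when later rows from column \<open>n\<close> are
  added, so small limits have to be secured when \<open>b\<close> and \<open>c\<close> are chosen; small \<open>S\<close> does the same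
  for the columns \<open>n\<close> that are still to come.
\<close>

definition half_selection ::
  "real \<Rightarrow> matrix4 \<Rightarrow> (nat \<Rightarrow> nat \<times> nat \<Rightarrow> nat \<times> nat \<Rightarrow> real) \<Rightarrow> (nat \<times> nat \<Rightarrow> nat \<times> nat \<Rightarrow> real) \<Rightarrow>
    (nat \<Rightarrow> nat) \<Rightarrow> (nat \<Rightarrow> nat \<times> nat) \<Rightarrow> nat \<Rightarrow> (nat \<Rightarrow> nat \<times> nat) \<Rightarrow> nat \<Rightarrow> bool" where
  "half_selection \<eta> t s S \<nu> a N b M \<longleftrightarrow>
     (\<forall>i<N. fst (a i) = \<nu> (fst (prod_decode i))) \<and>
     (\<forall>i<N. \<forall>i'<i. \<nu> i' < \<nu> i \<and> a i' \<noteq> a i) \<and>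
     (\<forall>i<N. \<forall>j<M. \<forall>j'<M. j \<noteq> j' \<longrightarrow> \<bar>t (a i) (b j) (a i) (b j')\<bar> < dev \<eta> j j') \<and>
     (\<forall>i<N. \<forall>j<M. \<forall>j'<M. j \<noteq> j' \<longrightarrow> \<bar>s (\<nu> i) (b j) (b j')\<bar> < dev \<eta> j j') \<and>
     (\<forall>j<M. \<forall>j'<M. j \<noteq> j' \<longrightarrow> \<bar>S (b j) (b j')\<bar> < dev \<eta> j j')"

lemma half_selectionD:
  assumes "half_selection \<eta> t s S \<nu> a N b M" "i < N" "j < M" "j' < M" "j \<noteq> j'"
  shows "\<bar>t (a i) (b j) (a i) (b j')\<bar> < dev \<eta> j j'"
  using assms by (simp only: half_selection_def) blast

definition cross_small ::
  "real \<Rightarrow> matrix4 \<Rightarrow> (nat \<Rightarrow> nat \<times> nat) \<Rightarrow> nat \<Rightarrow> (nat \<Rightarrow> nat \<times> nat) \<Rightarrow> nat \<Rightarrow> bool" where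
  "cross_small \<eta> t a N b M \<longleftrightarrow>
     (\<forall>i<N. \<forall>i'<N. \<forall>j<M. \<forall>j'<M. i \<noteq> i' \<longrightarrow> j \<noteq> j' \<longrightarrow>
        \<bar>t (a i) (b j) (a i') (b j')\<bar> < dev (dev \<eta> i i') j j')"

text \<open>\<open>s\<close>, \<open>S\<close> are meant as the iterated limits of \<open>t\<close>,
  and \<open>u\<close>, \<open>U\<close> as those of \<open>flip t\<close>. The lengths
  \<open>N\<close> and \<open>M\<close> are separate because the two sequences grow
  alternately.\<close>

definition selection where
  "selection \<eta> t s S u U \<nu> a N \<mu> b M \<longleftrightarrow>
     half_selection \<eta> t s S \<nu> a N b M \<and> half_selection \<eta> (flip t) u U \<mu> b M a N \<and>
     cross_small \<eta> t a N b M"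

lemma cross_small_flip:
  assumes "cross_small \<eta> t a N b M"
  shows "cross_small \<eta> (flip t) b M a N"
  unfolding cross_small_def
proof (intro allI impI)
  fix j j' i i' assume "j < M" "j' < M" "i < N" "i' < N" "j \<noteq> j'" "i \<noteq> i'"
  then have "\<bar>t (a i) (b j) (a i') (b j')\<bar> < dev (dev \<eta> i i') j j'"
    using assms unfolding cross_small_def by blast
  also have "\<dots> = dev (dev \<eta> j j') i i'"
    by simp
  finally show "\<bar>t (a i) (b j) (a i') (b j')\<bar> < dev (dev \<eta> j j') i i'" .
qed

lemma selection_flip:
  assumes "selection \<eta> t s S u U \<nu> a N \<mu> b M"
  shows "selection \<eta> (flip t) u U s S \<mu> b M \<nu> a N"
  using assms cross_small_flip unfolding selection_def by blast

text \<open>The schedule never looks ahead: the column prescribed for step \<open>i\<close> has been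
  chosen by then.\<close>

lemma fst_prod_decode_le: "fst (prod_decode i) \<le> i"
  by (metis le_prod_encode_1 prod.collapse prod_decode_inverse)

text \<open>The conditions on the new column \<open>n\<close> and the new index \<open>x\<close> are
  finite in number and eventually true, along \<open>\<Psi>\<close> and along the filter of the
  scheduled column respectively, so suitable \<open>n\<close> and \<open>x\<close> exist.\<close>

lemma selection_step:
  assumes \<eta>: "0 < \<eta>" and lim: "iterated_limit t \<Phi> \<Psi> s S"
    and null: "\<And>b c. columns_null (\<lambda>a a'. t a b a' c)" "\<And>m. columns_null (u m)" "columns_null U"
    and sel: "selection \<eta> t s S u U \<nu> a N \<mu> b M"
  shows "\<exists>n x. selection \<eta> t s S u U (\<nu>(N := n)) (a(N := x)) (Suc N) \<mu> b M"
proof -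
  have S: "\<forall>j\<in>{..<M}. \<forall>j'\<in>{..<M}. j \<noteq> j' \<longrightarrow> \<bar>S (b j) (b j')\<bar> < dev \<eta> j j'"
    using sel by (auto simp: selection_def half_selection_def)
  have \<Psi>: "\<Psi> \<noteq> bot" "\<Psi> \<le> sequentially" "((\<lambda>n. s n b c) \<longlongrightarrow> S b c) \<Psi>" for b c
    using lim by (simp_all add: iterated_limit_def)
  have "eventually (\<lambda>n. \<forall>i\<in>{..<N}. \<nu> i < n) \<Psi>"
    using filter_leD[OF \<Psi>(2) eventually_gt_at_top] by (simp add: eventually_ball_finite_distrib)
  moreover have "eventually (\<lambda>n. \<forall>j\<in>{..<M}. \<forall>j'\<in>{..<M}. j \<noteq> j' \<longrightarrow> \<bar>s n (b j) (b j')\<bar> < dev \<eta> j j') \<Psi>"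
    using S by (auto simp: eventually_ball_finite_distrib
        intro!: order_tendstoD(2)[OF tendsto_rabs[OF \<Psi>(3)]])
  ultimately have "eventually (\<lambda>n. (\<forall>i\<in>{..<N}. \<nu> i < n) \<and>
      (\<forall>j\<in>{..<M}. \<forall>j'\<in>{..<M}. j \<noteq> j' \<longrightarrow> \<bar>s n (b j) (b j')\<bar> < dev \<eta> j j')) \<Psi>"
    by (rule eventually_conj)
  from eventually_happens'[OF \<Psi>(1) this] obtain n where n: "\<And>i. i < N \<Longrightarrow> \<nu> i < n"
    "\<And>j j'. j < M \<Longrightarrow> j' < M \<Longrightarrow> j \<noteq> j' \<Longrightarrow> \<bar>s n (b j) (b j')\<bar> < dev \<eta> j j'"
    by (auto simp: Ball_def)
  \<comment> \<open>The column scheduled for step \<open>N\<close>: an earlier one, or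
    \<open>n\<close> itself if the schedule points to \<open>N\<close>. In both cases its limits
    \<open>s q\<close> are already small.\<close>
  define q where "q = (\<nu>(N := n)) (fst (prod_decode N))"
  have q: "\<bar>s q (b j) (b j')\<bar> < dev \<eta> j j'" if "j < M" "j' < M" "j \<noteq> j'" for j j'
    using that n(2)[OF that] sel fst_prod_decode_le[of N]
    by (auto simp: q_def selection_def half_selection_def)
  have \<Phi>: "\<Phi> q \<noteq> bot" "\<Phi> q \<le> column q" "((\<lambda>a. t a b a c) \<longlongrightarrow> s q b c) (\<Phi> q)" for b c
    using lim by (simp_all add: iterated_limit_def)
  have nt: "eventually (\<lambda>x. \<bar>\<tau> x c\<bar> < e) (\<Phi> q)" "eventually (\<lambda>x. \<bar>\<tau> c x\<bar> < e) (\<Phi> q)"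
    if "columns_null \<tau>" "0 < e" for \<tau> c and e :: real
  proof -
    have "((\<lambda>x. \<tau> x c) \<longlongrightarrow> 0) (\<Phi> q)" "((\<lambda>x. \<tau> c x) \<longlongrightarrow> 0) (\<Phi> q)"
      using that(1) by (auto simp: columns_null_def intro!: tendsto_mono[OF \<Phi>(2)])
    then show "eventually (\<lambda>x. \<bar>\<tau> x c\<bar> < e) (\<Phi> q)" "eventually (\<lambda>x. \<bar>\<tau> c x\<bar> < e) (\<Phi> q)"
      using order_tendstoD(2)[OF tendsto_rabs_zero that(2)] by blast+
  qed
  have "eventually (\<lambda>x. fst x = q) (\<Phi> q)"
    using column_fst \<Phi>(2) filter_leD by blast
  moreover have "eventually (\<lambda>x. \<forall>i\<in>{..<N}. a i \<noteq> x) (\<Phi> q)"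
    using filter_leD[OF \<Phi>(2) column_neq] by (simp add: eventually_ball_finite_distrib)
  \<comment> \<open>These entries tend to \<open>s q (b j) (b j')\<close>, which need not be 0; they
    become small because the limits of \<open>q\<close> were kept small in advance.\<close>
  moreover have "eventually (\<lambda>x. \<forall>j\<in>{..<M}. \<forall>j'\<in>{..<M}. j \<noteq> j' \<longrightarrow> \<bar>t x (b j) x (b j')\<bar> < dev \<eta> j j') (\<Phi> q)"
    using q by (auto simp: eventually_ball_finite_distrib
        intro!: order_tendstoD(2)[OF tendsto_rabs[OF \<Phi>(3)]])
  moreover have "eventually (\<lambda>x. \<forall>i\<in>{..<N}. \<forall>j\<in>{..<M}. \<forall>j'\<in>{..<M}.
      \<bar>t x (b j) (a i) (b j')\<bar> < dev (dev \<eta> i N) j j' \<and> \<bar>t (a i) (b j) x (b j')\<bar> < dev (dev \<eta> i N) j j') (\<Phi> q)"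
    using nt[OF null(1)] \<eta> by (simp add: eventually_ball_finite_distrib eventually_conj_iff)
  moreover have "eventually (\<lambda>x. \<forall>i\<in>{..<N}. \<forall>j\<in>{..<M}.
      \<bar>t x (b j) (a i) (b j)\<bar> < dev \<eta> i N \<and> \<bar>t (a i) (b j) x (b j)\<bar> < dev \<eta> i N) (\<Phi> q)"
    using nt[OF null(1)] \<eta> by (simp add: eventually_ball_finite_distrib eventually_conj_iff)
  \<comment> \<open>Conditions for the flipped half: \<open>u\<close> and \<open>U\<close> have to
    be small at the new pairs, so that later indices of the other factor can still be found.\<close>
  moreover have "eventually (\<lambda>x. \<forall>i\<in>{..<N}. \<forall>j\<in>{..<M}.
      \<bar>u (\<mu> j) x (a i)\<bar> < dev \<eta> i N \<and> \<bar>u (\<mu> j) (a i) x\<bar> < dev \<eta> i N) (\<Phi> q)"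
    using nt[OF null(2)] \<eta> by (simp add: eventually_ball_finite_distrib eventually_conj_iff)
  moreover have "eventually (\<lambda>x. \<forall>i\<in>{..<N}. \<bar>U x (a i)\<bar> < dev \<eta> i N \<and> \<bar>U (a i) x\<bar> < dev \<eta> i N) (\<Phi> q)"
    using nt[OF null(3)] \<eta> by (simp add: eventually_ball_finite_distrib eventually_conj_iff)
  ultimately have "eventually (\<lambda>x. fst x = q \<and> (\<forall>i\<in>{..<N}. a i \<noteq> x) \<and>
     (\<forall>j\<in>{..<M}. \<forall>j'\<in>{..<M}. j \<noteq> j' \<longrightarrow> \<bar>t x (b j) x (b j')\<bar> < dev \<eta> j j') \<and>
     (\<forall>i\<in>{..<N}. \<forall>j\<in>{..<M}. \<forall>j'\<in>{..<M}.
      \<bar>t x (b j) (a i) (b j')\<bar> < dev (dev \<eta> i N) j j' \<and> \<bar>t (a i) (b j) x (b j')\<bar> < dev (dev \<eta> i N) j j') \<and>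
     (\<forall>i\<in>{..<N}. \<forall>j\<in>{..<M}.
      \<bar>t x (b j) (a i) (b j)\<bar> < dev \<eta> i N \<and> \<bar>t (a i) (b j) x (b j)\<bar> < dev \<eta> i N) \<and>
     (\<forall>i\<in>{..<N}. \<forall>j\<in>{..<M}.
      \<bar>u (\<mu> j) x (a i)\<bar> < dev \<eta> i N \<and> \<bar>u (\<mu> j) (a i) x\<bar> < dev \<eta> i N) \<and>
     (\<forall>i\<in>{..<N}. \<bar>U x (a i)\<bar> < dev \<eta> i N \<and> \<bar>U (a i) x\<bar> < dev \<eta> i N)) (\<Phi> q)"
    by (intro eventually_conj)
  from eventually_happens'[OF \<Phi>(1) this] obtain x where x: "fst x = q" "\<forall>i<N. a i \<noteq> x"
    "\<forall>j<M. \<forall>j'<M. j \<noteq> j' \<longrightarrow> \<bar>t x (b j) x (b j')\<bar> < dev \<eta> j j'"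
    "\<forall>i<N. \<forall>j<M. \<forall>j'<M. \<bar>t x (b j) (a i) (b j')\<bar> < dev (dev \<eta> i N) j j' \<and>
        \<bar>t (a i) (b j) x (b j')\<bar> < dev (dev \<eta> i N) j j'"
    "\<forall>i<N. \<forall>j<M. \<bar>t x (b j) (a i) (b j)\<bar> < dev \<eta> i N \<and> \<bar>t (a i) (b j) x (b j)\<bar> < dev \<eta> i N"
    "\<forall>i<N. \<forall>j<M. \<bar>u (\<mu> j) x (a i)\<bar> < dev \<eta> i N \<and> \<bar>u (\<mu> j) (a i) x\<bar> < dev \<eta> i N"
    "\<forall>i<N. \<bar>U x (a i)\<bar> < dev \<eta> i N \<and> \<bar>U (a i) x\<bar> < dev \<eta> i N"
    by (auto simp: Ball_def)
  let ?\<nu> = "\<nu>(N := n)" and ?a = "a(N := x)"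
  have old: "?\<nu> i = \<nu> i" "?a i = a i" "?\<nu> (fst (prod_decode i)) = \<nu> (fst (prod_decode i))" if "i < N" for i
    using that fst_prod_decode_le[of i] by auto
  have new: "?\<nu> N = n" "?a N = x" "?\<nu> (fst (prod_decode N)) = q"
    by (simp_all add: q_def)
  have comm: "dev \<eta> N i = dev \<eta> i N" for i
    by (simp add: mult_ac)
  have "half_selection \<eta> t s S ?\<nu> ?a (Suc N) b M"
    using sel x(1-3) n unfolding selection_def half_selection_def
    by (simp add: All_less_Suc old new del: fun_upd_apply)
  moreover have "half_selection \<eta> (flip t) u U \<mu> b M ?a (Suc N)"
    using sel x(5-7) unfolding selection_def half_selection_def
    by (simp add: All_less_Suc old new comm del: fun_upd_apply)
  moreover have "cross_small \<eta> t ?a (Suc N) b M"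
    using sel x(4) unfolding selection_def cross_small_def
    by (simp add: All_less_Suc old new comm del: fun_upd_apply)
  ultimately show ?thesis
    unfolding selection_def by blast
qed

text \<open>Only values below \<open>N\<close> and \<open>M\<close> enter, also through the
  schedule, so the sequences of a stage may be replaced by the limiting ones.\<close>

lemma selection_cong:
  assumes "\<And>i. i < N \<Longrightarrow> \<nu> i = \<nu>' i" "\<And>i. i < N \<Longrightarrow> a i = a' i"
    and "\<And>j. j < M \<Longrightarrow> \<mu> j = \<mu>' j" "\<And>j. j < M \<Longrightarrow> b j = b' j"
    and sel: "selection \<eta> t s S u U \<nu> a N \<mu> b M"
  shows "selection \<eta> t s S u U \<nu>' a' N \<mu>' b' M"
proof -
  have d: "\<nu>' (fst (prod_decode i)) = \<nu> (fst (prod_decode i))" if "i < N" for i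
    using assms(1)[of "fst (prod_decode i)"] fst_prod_decode_le[of i] that by linarith
  have e: "\<mu>' (fst (prod_decode i)) = \<mu> (fst (prod_decode i))" if "i < M" for i
    using assms(3)[of "fst (prod_decode i)"] fst_prod_decode_le[of i] that by linarith
  show ?thesis
    using sel unfolding selection_def half_selection_def cross_small_def
    by (simp add: assms(1-4)[symmetric] d e del: One_nat_def)
qed

text \<open>Dependent choice with one step in each factor per stage, the second step being the first
  applied to \<open>flip t\<close>. The diagonal through the stages then satisfies the conditions
  for all \<open>N\<close>.\<close>

lemma selection_exists:
  assumes \<eta>: "0 < \<eta>" and lim: "iterated_limit t \<Phi> \<Psi> s S" "iterated_limit (flip t) \<Phi>' \<Psi>' u U"
    and null: "\<And>b c. columns_null (\<lambda>a a'. t a b a' c)" "\<And>m. columns_null (u m)" "columns_null U"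
      "\<And>a c. columns_null (\<lambda>b b'. t a b c b')" "\<And>n. columns_null (s n)" "columns_null S"
  shows "\<exists>\<nu> a \<mu> b. \<forall>N. selection \<eta> t s S u U \<nu> a N \<mu> b N"
proof -
  let ?P = "\<lambda>N (\<nu>, a, \<mu>, b). selection \<eta> t s S u U \<nu> a N \<mu> b N"
  let ?Q = "\<lambda>N (\<nu>, a, \<mu>, b) (\<nu>', a', \<mu>', b'). \<exists>n x m y.
      \<nu>' = \<nu>(N := n) \<and> a' = a(N := x) \<and> \<mu>' = \<mu>(N := m) \<and> b' = b(N := y)"
  have "\<exists>f. \<forall>N. ?P N (f N) \<and> ?Q N (f N) (f (Suc N))"
  proof (rule dependent_nat_choice)
    show "\<exists>z. ?P 0 z"
      by (auto simp: selection_def half_selection_def cross_small_def)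
  next
    fix z :: "(nat \<Rightarrow> nat) \<times> (nat \<Rightarrow> nat \<times> nat) \<times> (nat \<Rightarrow> nat) \<times> (nat \<Rightarrow> nat \<times> nat)" and N
    assume "?P N z"
    moreover obtain \<nu> a \<mu> b where z: "z = (\<nu>, a, \<mu>, b)"
      using prod_cases4 by blast
    ultimately have "selection \<eta> t s S u U \<nu> a N \<mu> b N"
      by simp
    from selection_step[OF \<eta> lim(1) null(1-3) this] obtain n x where "selection \<eta> t s S u U (\<nu>(N := n)) (a(N := x)) (Suc N) \<mu> b N"
      by blast
    then have "selection \<eta> (flip t) u U s S \<mu> b N (\<nu>(N := n)) (a(N := x)) (Suc N)"
      by (rule selection_flip)
    from selection_step[where t = "flip t", OF \<eta> lim(2) null(4-6) this] obtain m y where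
      "selection \<eta> (flip t) u U s S (\<mu>(N := m)) (b(N := y)) (Suc N) (\<nu>(N := n)) (a(N := x)) (Suc N)"
      by blast
    then have "?P (Suc N) (\<nu>(N := n), a(N := x), \<mu>(N := m), b(N := y))"
      using selection_flip by fastforce
    then show "\<exists>z'. ?P (Suc N) z' \<and> ?Q N z z'"
      unfolding z by blast
  qed
  then obtain f where f': "\<forall>N. ?P N (f N) \<and> ?Q N (f N) (f (Suc N))" ..
  have f: "?P N (f N)" "?Q N (f N) (f (Suc N))" for N
    using f'[rule_format, of N] by (rule conjunct1, rule conjunct2)
  define F1 F2 F3 F4 where "F1 N = fst (f N)" "F2 N = fst (snd (f N))"
    "F3 N = fst (snd (snd (f N)))" "F4 N = snd (snd (snd (f N)))" for N
  have F: "f N = (F1 N, F2 N, F3 N, F4 N)" for N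
    by (simp add: F1_F2_F3_F4_def)
  have P: "selection \<eta> t s S u U (F1 N) (F2 N) N (F3 N) (F4 N) N" for N
    using f(1)[of N] by (simp add: F)
  have Q: "F1 (Suc N) i = F1 N i" "F2 (Suc N) i = F2 N i" "F3 (Suc N) i = F3 N i" "F4 (Suc N) i = F4 N i"
    if "i < N" for N i
    using f(2)[of N] that by (auto simp: F)
  \<comment> \<open>Position \<open>i\<close> is filled in passing to stage \<open>Suc i\<close> and
    never changed again.\<close>
  have eq: "F1 N i = F1 (Suc i) i \<and> F2 N i = F2 (Suc i) i \<and> F3 N i = F3 (Suc i) i \<and> F4 N i = F4 (Suc i) i"
    if "i < N" for N i
    using that
  proof (induction N)
    case (Suc N)
    then show ?case
      using Q[of i N] by (cases "i = N") auto
  qed simp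
  have "selection \<eta> t s S u U (\<lambda>i. F1 (Suc i) i) (\<lambda>i. F2 (Suc i) i) N (\<lambda>i. F3 (Suc i) i) (\<lambda>i. F4 (Suc i) i) N"
    for N
    by (rule selection_cong[OF _ _ _ _ P[of N]]) (use eq in blast)+
  then show ?thesis
    by blast
qed

text \<open>The steps \<open>prod_encode (i, k)\<close> for varying \<open>k\<close> all fall in
  column \<open>\<nu> i\<close>; injectivity of \<open>a\<close> makes their indices infinitely
  many, and injectivity of \<open>\<nu>\<close> gives infinitely many columns.\<close>

lemma rich_range:
  assumes fst: "\<And>i. fst (a i) = \<nu> (fst (prod_decode i))" and "inj \<nu>" "inj a"
  shows "rich (range a)"
  unfolding rich_def
proof (intro exI conjI ballI)
  show "infinite (range \<nu>)"
    using \<open>inj \<nu>\<close> by (simp add: finite_image_iff)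
  fix m assume "m \<in> range \<nu>"
  then obtain i where m: "m = \<nu> i"
    by auto
  have "inj (\<lambda>k. a (prod_encode (i, k)))"
    by (rule injI) (use \<open>inj a\<close> in \<open>auto dest!: injD\<close>)
  then have "infinite (range (\<lambda>k. a (prod_encode (i, k))))"
    by (simp add: finite_image_iff)
  moreover have "range (\<lambda>k. a (prod_encode (i, k))) \<subseteq> {(m, k) | k. (m, k) \<in> range a}"
  proof safe
    fix k p q assume "(p, q) = a (prod_encode (i, k))"
    then show "\<exists>k. (p, q) = (m, k) \<and> (m, k) \<in> range a"
      using fst[of "prod_encode (i, k)"] by (metis fst_conv m prod_encode_inverse rangeI)
  qed
  ultimately show "infinite {(m, k) | k. (m, k) \<in> range a}"
    using finite_subset by blast
qed

lemma rich_selection: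
  assumes \<eta>: "0 < \<eta>" and bd: "\<And>a b a' b'. \<bar>t a b a' b'\<bar> \<le> R"
    and thin: "\<And>b c. columns_thin B (\<lambda>a a'. t a b a' c)" "\<And>a c. columns_thin B (\<lambda>b b'. t a b c b')"
  obtains a b where "inj a" "inj b" "rich (range a)" "rich (range b)"
    "\<And>i i' j j'. i \<noteq> i' \<Longrightarrow> j \<noteq> j' \<Longrightarrow> \<bar>t (a i) (b j) (a i') (b j')\<bar> \<le> dev (dev \<eta> i i') j j'"
    "\<And>i j j'. j \<noteq> j' \<Longrightarrow> \<bar>t (a i) (b j) (a i) (b j')\<bar> \<le> dev \<eta> j j'"
    "\<And>i i' j. i \<noteq> i' \<Longrightarrow> \<bar>t (a i) (b j) (a i') (b j)\<bar> \<le> dev \<eta> i i'"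
proof -
  obtain \<Phi> \<Psi> s S where 1: "iterated_limit t \<Phi> \<Psi> s S" "\<And>n. columns_null (s n)" "columns_null S"
    by (rule iterated_limit_exists[of t R B]) (use bd thin in auto)
  obtain \<Phi>' \<Psi>' u U where 2: "iterated_limit (flip t) \<Phi>' \<Psi>' u U" "\<And>n. columns_null (u n)" "columns_null U"
    by (rule iterated_limit_exists[of "flip t" R B]) (use bd thin in auto)
  obtain \<nu> a \<mu> b where sel: "\<And>N. selection \<eta> t s S u U \<nu> a N \<mu> b N"
    using selection_exists[OF \<eta> 1(1) 2(1) _ 2(2,3) _ 1(2,3)] thin columns_thin_null by blast
  have h: "half_selection \<eta> t s S \<nu> a N b N" "half_selection \<eta> (flip t) u U \<mu> b N a N"
    "cross_small \<eta> t a N b N" for N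
    using sel[of N] by (simp_all add: selection_def)
  have mono: "\<nu> i' < \<nu> i \<and> a i' \<noteq> a i" "\<mu> i' < \<mu> i \<and> b i' \<noteq> b i" if "i' < i" for i i'
    using h(1)[of "Suc i"] h(2)[of "Suc i"] that by (simp_all add: half_selection_def)
  have inj: "inj \<nu>" "inj a" "inj \<mu>" "inj b"
    using mono by (metis injI nat_neq_iff)+
  have fst: "fst (a i) = \<nu> (fst (prod_decode i))" "fst (b i) = \<mu> (fst (prod_decode i))" for i
    using h(1)[of "Suc i"] h(2)[of "Suc i"] by (simp_all add: half_selection_def)
  show ?thesis
  proof (rule that)
    show "inj a" "inj b" "rich (range a)" "rich (range b)"
      using inj rich_range[of a \<nu>, OF fst(1)] rich_range[of b \<mu>, OF fst(2)] by auto
    fix i j j' :: nat assume "j \<noteq> j'"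
    let ?N = "Suc (max i (max j j'))"
    have "i < ?N" "j < ?N" "j' < ?N" by auto
    from half_selectionD[OF h(1) this \<open>j \<noteq> j'\<close>]
    show "\<bar>t (a i) (b j) (a i) (b j')\<bar> \<le> dev \<eta> j j'"
      by (rule less_imp_le)
  next
    fix i i' j :: nat assume "i \<noteq> i'"
    let ?N = "Suc (max i (max i' j))"
    have "j < ?N" "i < ?N" "i' < ?N" by auto
    from half_selectionD[OF h(2) this \<open>i \<noteq> i'\<close>]
    show "\<bar>t (a i) (b j) (a i') (b j)\<bar> \<le> dev \<eta> i i'"
      by (rule less_imp_le)
  next
    fix i i' j j' :: nat assume "i \<noteq> i'" "j \<noteq> j'"
    let ?N = "Suc (max (max i i') (max j j'))"
    have "i < ?N" "i' < ?N" "j < ?N" "j' < ?N" by auto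
    with \<open>i \<noteq> i'\<close> \<open>j \<noteq> j'\<close> h(3)[of ?N]
    show "\<bar>t (a i) (b j) (a i') (b j')\<bar> \<le> dev (dev \<eta> i i') j j'"
      unfolding cross_small_def using less_imp_le by blast
  qed
qed

declare split_paired_All [simp] split_paired_Ex [simp]

section \<open>The off-diagonal part is small\<close>

text \<open>Regroups the entries that keep \<open>i\<close> by the pair \<open>j\<close>,
  \<open>j'\<close>, so that each inner sum lies in a single row and \<open>norm_row_shift\<close>
  applies.\<close>

lemma sum_collapse_first:
  fixes f :: "'a \<Rightarrow> 'b \<Rightarrow> 'a \<Rightarrow> 'b \<Rightarrow> 'c::comm_monoid_add"
  assumes "finite A"
  shows "(\<Sum>i'\<in>A. \<Sum>j'\<in>B. \<Sum>i\<in>A. \<Sum>j\<in>B. if i = i' \<and> j \<noteq> j' then f i j i' j' else 0) =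
     (\<Sum>j\<in>B. \<Sum>j'\<in>B. \<Sum>i\<in>A. if j \<noteq> j' then f i j i j' else 0)"
proof -
  have "(\<Sum>i'\<in>A. \<Sum>j'\<in>B. \<Sum>i\<in>A. \<Sum>j\<in>B. if i = i' \<and> j \<noteq> j' then f i j i' j' else 0) =
      (\<Sum>i'\<in>A. \<Sum>j'\<in>B. \<Sum>j\<in>B. \<Sum>i\<in>A. if i = i' then (if j \<noteq> j' then f i j i' j' else 0) else 0)"
    by (intro sum.cong refl, subst sum.swap) (auto intro!: sum.cong)
  also have "\<dots> = (\<Sum>i'\<in>A. \<Sum>j'\<in>B. \<Sum>j\<in>B. if j \<noteq> j' then f i' j i' j' else 0)"
    by (intro sum.cong refl) (use assms in simp)
  also have "\<dots> = (\<Sum>i'\<in>A. \<Sum>j\<in>B. \<Sum>j'\<in>B. if j \<noteq> j' then f i' j i' j' else 0)"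
    by (rule sum.cong[OF refl], rule sum.swap)
  also have "\<dots> = (\<Sum>j\<in>B. \<Sum>i'\<in>A. \<Sum>j'\<in>B. if j \<noteq> j' then f i' j i' j' else 0)"
    by (rule sum.swap)
  also have "\<dots> = (\<Sum>j\<in>B. \<Sum>j'\<in>B. \<Sum>i\<in>A. if j \<noteq> j' then f i j i j' else 0)"
    by (rule sum.cong[OF refl], rule sum.swap)
  finally show ?thesis .
qed

text \<open>The same regrouping by pairs of columns, for \<open>norm_column_shift\<close>.\<close>

lemma sum_collapse_second:
  fixes f :: "'a \<Rightarrow> 'b \<Rightarrow> 'a \<Rightarrow> 'b \<Rightarrow> 'c::comm_monoid_add"
  assumes "finite B"
  shows "(\<Sum>i'\<in>A. \<Sum>j'\<in>B. \<Sum>i\<in>A. \<Sum>j\<in>B. if i \<noteq> i' \<and> j = j' then f i j i' j' else 0) =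
     (\<Sum>i\<in>A. \<Sum>i'\<in>A. \<Sum>j\<in>B. if i \<noteq> i' then f i j i' j else 0)"
proof -
  have "(\<Sum>i'\<in>A. \<Sum>j'\<in>B. \<Sum>i\<in>A. \<Sum>j\<in>B. if i \<noteq> i' \<and> j = j' then f i j i' j' else 0) =
      (\<Sum>i'\<in>A. \<Sum>j'\<in>B. \<Sum>i\<in>A. \<Sum>j\<in>B. if j = j' then (if i \<noteq> i' then f i j i' j' else 0) else 0)"
    by (intro sum.cong refl) auto
  also have "\<dots> = (\<Sum>i'\<in>A. \<Sum>j'\<in>B. \<Sum>i\<in>A. if i \<noteq> i' then f i j' i' j' else 0)"
    by (intro sum.cong refl) (use assms in simp)
  also have "\<dots> = (\<Sum>i'\<in>A. \<Sum>i\<in>A. \<Sum>j'\<in>B. if i \<noteq> i' then f i j' i' j' else 0)"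
    by (rule sum.cong[OF refl], rule sum.swap)
  also have "\<dots> = (\<Sum>i\<in>A. \<Sum>i'\<in>A. \<Sum>j\<in>B. if i \<noteq> i' then f i j i' j else 0)"
    by (rule sum.swap)
  finally show ?thesis .
qed

lemma subspace_closure:
  fixes S :: "'a::real_normed_vector set"
  assumes "subspace S"
  shows "subspace (closure S)"
proof (rule subspaceI)
  show "0 \<in> closure S"
    using assms closure_subset subspace_0 by blast
  fix x y assume "x \<in> closure S" "y \<in> closure S"
  then obtain f g where "\<And>n. f n \<in> S" "f \<longlonglongrightarrow> x" "\<And>n. g n \<in> S" "g \<longlonglongrightarrow> y"
    unfolding closure_sequential by blast
  then have "\<And>n. f n + g n \<in> S" "(\<lambda>n. f n + g n) \<longlonglongrightarrow> x + y"
    using assms by (auto intro: subspace_add tendsto_add)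
  then show "x + y \<in> closure S"
    unfolding closure_sequential by (intro exI[of _ "\<lambda>n. f n + g n"] conjI allI)
next
  fix r x assume "x \<in> closure S"
  then obtain f where "\<And>n. f n \<in> S" "f \<longlonglongrightarrow> x"
    unfolding closure_sequential by blast
  then have "\<And>n. r *\<^sub>R f n \<in> S" "(\<lambda>n. r *\<^sub>R f n) \<longlonglongrightarrow> r *\<^sub>R x"
    using assms by (auto intro: subspace_scale tendsto_intros)
  then show "r *\<^sub>R x \<in> closure S"
    unfolding closure_sequential by (intro exI[of _ "\<lambda>n. r *\<^sub>R f n"] conjI allI)
qed

lemma geometric_half_le: "(\<Sum>i<n. (1 / 2) ^ i) \<le> (2 :: real)"
  unfolding sum_gp_strict by simp

lemma thin_mono: "thin B f \<Longrightarrow> (\<And>\<delta>. 0 < \<delta> \<Longrightarrow> B \<delta> \<le> B' \<delta>) \<Longrightarrow> thin B' f"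
  unfolding thin_def by (meson order_trans)

section \<open>Comparison with the identity on the selected subspace, and decay of the matrix
  entries\<close>

context Xp_tensor_space
begin

abbreviation rect_span :: "(nat \<Rightarrow> 'i) \<Rightarrow> (nat \<Rightarrow> 'i) \<Rightarrow> 'e set" where
  "rect_span a b \<equiv> span {E (a i, b j) | i j. True}"

definition square :: "(nat \<Rightarrow> 'i) \<Rightarrow> (nat \<Rightarrow> 'i) \<Rightarrow> nat \<Rightarrow> ('i \<times> 'i) set" where
  "square a b L = (\<lambda>(i, j). (a i, b j)) ` ({..<L} \<times> {..<L})"

lemma finite_square: "finite (square a b L)"
  by (simp add: square_def)

lemma sum_square:
  assumes "inj a" "inj b"
  shows "sum f (square a b L) = (\<Sum>i<L. \<Sum>j<L. f (a i, b j))"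
proof -
  have "inj_on (\<lambda>(i, j). (a i, b j)) ({..<L} \<times> {..<L})"
    using assms by (auto simp: inj_on_def dest: injD)
  then show ?thesis
    unfolding square_def by (subst sum.reindex) (auto simp: sum.cartesian_product case_prod_unfold)
qed

lemma proj_square_eventually_id:
  assumes "z \<in> rect_span a b"
  shows "eventually (\<lambda>L. proj (square a b L) z = z) sequentially"
  using assms
proof (induction rule: span_induct_alt)
  case base
  interpret P: bounded_linear "proj (square a b L)" for L by (rule proj_linear)
  show ?case by (simp add: P.zero)
next
  case (step r x z)
  interpret P: bounded_linear "proj (square a b L)" for L by (rule proj_linear)
  obtain i j where x: "x = E (a i, b j)"
    using step.hyps by blast
  have "eventually (\<lambda>L. proj (square a b L) x = x) sequentially"
    using eventually_gt_at_top[of "max i j"]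
  proof eventually_elim
    case (elim L)
    then have "(a i, b j) \<in> square a b L"
      by (auto simp: square_def)
    moreover have "proj (square a b L) x = (\<Sum>v\<in>square a b L. if v = (a i, b j) then x else 0)"
      unfolding proj_def by (rule sum.cong) (auto simp: coord_basis x)
    ultimately show ?case
      by (simp add: finite_square)
  qed
  with step.IH show ?case
    by eventually_elim (simp add: P.add P.scaleR)
qed

text \<open>The projections are bounded by \<open>C / c\<close> uniformly in \<open>L\<close> and
  eventually fix each vector of a dense set, so a bound for the projections of \<open>z\<close>
  passes to \<open>z\<close> without loss.\<close>

lemma norm_le_if_proj_square_le:
  assumes z: "z \<in> closure (rect_span a b)" and B: "eventually (\<lambda>L. norm (proj (square a b L) z) \<le> B) sequentially"
  shows "norm z \<le> B"
proof (rule field_le_epsilon)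
  interpret P: bounded_linear "proj (square a b L)" for L by (rule proj_linear)
  fix e :: real assume "0 < e"
  \<comment> \<open>The approximation error enters once directly and once through the projection, so
    \<open>d\<close> is chosen with \<open>d + C / c * d = e\<close>.\<close>
  define d where "d = e / (1 + C / c)"
  have pos: "0 < 1 + C / c"
    using C c by (simp add: add_pos_pos)
  then have "d * (1 + C / c) = e"
    by (simp add: d_def)
  then have d: "d + C / c * d = e"
    by (simp add: algebra_simps)
  have "0 < d"
    using \<open>0 < e\<close> pos by (simp add: d_def)
  obtain y where y: "y \<in> rect_span a b" "dist y z < d"
    using z \<open>0 < d\<close> by (auto simp: closure_approachable)
  have "eventually (\<lambda>L. norm z \<le> B + e) sequentially"
    using B proj_square_eventually_id[OF y(1)]
  proof eventually_elim
    case (elim L)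
    have "z = (z - y) + (proj (square a b L) (y - z) + proj (square a b L) z)"
      using elim(2) by (simp add: P.diff)
    then have "norm z \<le> norm (z - y) + (norm (proj (square a b L) (y - z)) + norm (proj (square a b L) z))"
      by (metis norm_triangle_ineq norm_triangle_mono order_refl)
    also have "\<dots> \<le> d + (C / c * d + B)"
    proof (intro add_mono)
      show "norm (z - y) \<le> d"
        using y(2) by (simp add: dist_norm norm_minus_commute)
      have "norm (proj (square a b L) (y - z)) \<le> C / c * norm (y - z)"
        by (rule norm_proj_le[OF finite_square])
      also have "\<dots> \<le> C / c * d"
        using y(2) C c by (intro mult_left_mono) (auto simp: dist_norm)
      finally show "norm (proj (square a b L) (y - z)) \<le> C / c * d" .
      show "norm (proj (square a b L) z) \<le> B"
        by (rule elim(1))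
    qed
    finally show ?case
      using d by simp
  qed
  then show "norm z \<le> B + e"
    by simp
qed

text \<open>Multiplication by \<open>m\<close> turns the diagonal into 1, which cancels against
  \<open>z\<close>. The rest splits by the coordinates that change: both (constant 16), only the
  second (4), only the first (4), together 24.\<close>

lemma norm_near_identity_le:
  fixes T :: "'e \<Rightarrow> 'e"
  defines "t \<equiv> (\<lambda>a b a' b'. coord (a', b') (T (E (a, b))))"
  assumes T: "bounded_linear T" and inj: "inj a" "inj b" and \<epsilon>: "0 < \<epsilon>" and \<eta>: "0 \<le> \<eta>"
    and m: "\<And>i j. m (a i, b j) * t (a i) (b j) (a i) (b j) = 1" "\<And>v. \<bar>m v\<bar> \<le> 1 / \<epsilon>"
    and U: "bounded_linear U" "\<And>v z. coord v (U z) = m v * coord v z"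
    and UZ: "range U \<subseteq> closure (rect_span a b)"
    and t1: "\<And>i i' j j'. i \<noteq> i' \<Longrightarrow> j \<noteq> j' \<Longrightarrow> \<bar>t (a i) (b j) (a i') (b j')\<bar> \<le> dev (dev \<eta> i i') j j'"
    and t2: "\<And>i j j'. j \<noteq> j' \<Longrightarrow> \<bar>t (a i) (b j) (a i) (b j')\<bar> \<le> dev \<eta> j j'"
    and t3: "\<And>i i' j. i \<noteq> i' \<Longrightarrow> \<bar>t (a i) (b j) (a i') (b j)\<bar> \<le> dev \<eta> i i'"
    and z: "z \<in> closure (rect_span a b)"
  shows "norm (U (T z) - z) \<le> 24 * (C / c) * (\<eta> / \<epsilon>) * norm z"
proof -
  interpret T: bounded_linear T by (rule T)
  interpret U: bounded_linear U by (rule U(1))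
  interpret co: bounded_linear "coord v" for v by (rule coord_linear)
  define K where "K = C / c * (\<eta> / \<epsilon>)"
  have K: "0 \<le> K"
    using C c \<epsilon> \<eta> by (simp add: K_def)
  have main: "norm (U (T z) - z) \<le> 24 * K * norm z" if z: "z \<in> rect_span a b" for z
  proof (rule norm_le_if_proj_square_le)
    have "z \<in> closure (rect_span a b)"
      using z closure_subset by blast
    \<comment> \<open>The projections onto the squares control the norm only of vectors in this
      closure; \<open>UZ\<close> places the difference there.\<close>
    then show "U (T z) - z \<in> closure (rect_span a b)"
      using UZ by (intro subspace_diff subspace_closure) auto
    show "eventually (\<lambda>L. norm (proj (square a b L) (U (T z) - z)) \<le> 24 * K * norm z) sequentially"
      using proj_square_eventually_id[OF z]
    proof eventually_elim
      case (elim L)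
      define x where "x i j = coord (a i, b j) z" for i j
      \<comment> \<open>The contribution of the component of \<open>z\<close> at
        \<open>(i, j)\<close> to the coordinate of \<open>U (T z)\<close> at
        \<open>(i', j')\<close>.\<close>
      define X where "X i j i' j' = m (a i', b j') * (x i j * t (a i) (b j) (a i') (b j'))" for i j i' j'
      define e where "e i j = E (a i, b j)" for i j
      have z_sum: "z = (\<Sum>i<L. \<Sum>j<L. x i j *\<^sub>R e i j)"
        using elim unfolding proj_def sum_square[OF inj] x_def e_def by simp
      have coeff: "coord (a i', b j') (U (T z) - z) =
          (\<Sum>i<L. \<Sum>j<L. if i = i' \<and> j = j' then 0 else X i j i' j')" if "i' < L" "j' < L" for i' j'
      proof -
        have "coord (a i', b j') (T z) = (\<Sum>i<L. \<Sum>j<L. x i j * t (a i) (b j) (a i') (b j'))"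
          by (subst z_sum) (simp add: T.sum T.scaleR co.sum co.scaleR t_def e_def)
        then have "coord (a i', b j') (U (T z)) = (\<Sum>i<L. \<Sum>j<L. X i j i' j')"
          by (simp add: U(2) X_def sum_distrib_left)
        also have "\<dots> = (\<Sum>i<L. \<Sum>j<L. if i = i' \<and> j = j' then 0 else X i j i' j') +
            (\<Sum>i<L. \<Sum>j<L. if i = i' then (if j = j' then X i j i' j' else 0) else 0)"
          unfolding sum.distrib[symmetric] by (intro sum.cong refl) auto
        also have "(\<Sum>i<L. \<Sum>j<L. if i = i' then (if j = j' then X i j i' j' else 0) else 0) =
            (\<Sum>i<L. if i = i' then X i' j' i' j' else 0)"
          by (intro sum.cong refl) (use that in auto)
        \<comment> \<open>By the choice of \<open>m\<close> the diagonal entry returns exactly the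
          coordinate of \<open>z\<close>, which the subtraction of \<open>z\<close> removes.\<close>
        also have "\<dots> = coord (a i', b j') z"
          using that m(1)[of i' j'] by (simp add: X_def x_def mult_ac)
        finally show ?thesis
          by (simp add: co.diff)
      qed
      have "proj (square a b L) (U (T z) - z) =
          (\<Sum>i'<L. \<Sum>j'<L. \<Sum>i<L. \<Sum>j<L. (if i = i' \<and> j = j' then 0 else X i j i' j') *\<^sub>R e i' j')"
        unfolding proj_def sum_square[OF inj] e_def scaleR_sum_left[symmetric]
        by (intro sum.cong refl) (simp add: coeff)
      also have "\<dots> = (\<Sum>i'<L. \<Sum>j'<L. \<Sum>i<L. \<Sum>j<L. if i \<noteq> i' \<and> j \<noteq> j' then X i j i' j' *\<^sub>R e i' j' else 0) +
          ((\<Sum>i'<L. \<Sum>j'<L. \<Sum>i<L. \<Sum>j<L. if i = i' \<and> j \<noteq> j' then X i j i' j' *\<^sub>R e i' j' else 0) +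
          (\<Sum>i'<L. \<Sum>j'<L. \<Sum>i<L. \<Sum>j<L. if i \<noteq> i' \<and> j = j' then X i j i' j' *\<^sub>R e i' j' else 0))"
        unfolding sum.distrib[symmetric] by (intro sum.cong refl) auto
      also have "norm \<dots> \<le> 16 * K * norm z + (4 * K * norm z + 4 * K * norm z)"
      proof (intro order_trans[OF norm_triangle_ineq] add_mono)
        have Xle: "\<bar>X i j i' j'\<bar> \<le> d / \<epsilon> * \<bar>x i j\<bar>" if "\<bar>t (a i) (b j) (a i') (b j')\<bar> \<le> d" for i j i' j' d
        proof -
          have "\<bar>X i j i' j'\<bar> \<le> 1 / \<epsilon> * (\<bar>x i j\<bar> * d)"
            unfolding X_def abs_mult using that m(2) \<epsilon> by (intro mult_mono) auto
          then show ?thesis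
            by (simp add: mult_ac)
        qed
        have norm_z: "norm z = norm (\<Sum>v\<in>square a b L. coord v z *\<^sub>R E v)"
          using elim by (simp add: proj_def)
        have x_le: "c * \<bar>x i j\<bar> \<le> norm z" if "i < L" "j < L" for i j
        proof -
          have "\<bar>restr (square a b L) (\<lambda>v. coord v z) (a i, b j)\<bar> \<le>
              Xp_tensor_norm p w (restr (square a b L) (\<lambda>v. coord v z))"
            by (rule coord_le_Xp_tensor_norm) (use p in \<open>simp_all add: finsupp_restr finite_square\<close>)
          then have "c * \<bar>x i j\<bar> \<le> c * Xp_tensor_norm p w (restr (square a b L) (\<lambda>v. coord v z))"
            using that c by (intro mult_left_mono) (auto simp: restr_def square_def x_def split: if_splits)
          also have "\<dots> \<le> norm z"
            unfolding norm_z by (rule norm_sum_lower[OF finite_square])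
          finally show ?thesis .
        qed
        let ?h = "\<lambda>i. (1 / 2 :: real) ^ i" and ?S = "\<Sum>i<L. (1 / 2 :: real) ^ i"
        have S: "0 \<le> ?S" "?S \<le> 2"
          by (simp_all add: sum_nonneg geometric_half_le)
        \<comment> \<open>Bounded term by term: \<open>norm_basis_le\<close> costs \<open>C\<close>,
          \<open>x_le\<close> costs \<open>1 / c\<close>, and four geometric sums of at most 2 give
          16.\<close>
        have "norm (\<Sum>i'<L. \<Sum>j'<L. \<Sum>i<L. \<Sum>j<L. if i \<noteq> i' \<and> j \<noteq> j' then X i j i' j' *\<^sub>R e i' j' else 0)
            \<le> (\<Sum>i'<L. \<Sum>j'<L. \<Sum>i<L. \<Sum>j<L. ?h i' * (?h j' * (?h i * (?h j * (K * norm z)))))"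
        proof (intro sum_norm_le)
          fix i' j' i j assume "i' \<in> {..<L}" "j' \<in> {..<L}" "i \<in> {..<L}" "j \<in> {..<L}"
          show "norm (if i \<noteq> i' \<and> j \<noteq> j' then X i j i' j' *\<^sub>R e i' j' else 0)
              \<le> ?h i' * (?h j' * (?h i * (?h j * (K * norm z))))"
          proof (cases "i \<noteq> i' \<and> j \<noteq> j'")
            case True
            let ?d = "dev (dev \<eta> i i') j j'"
            have "norm (X i j i' j' *\<^sub>R e i' j') \<le> (?d / \<epsilon> * \<bar>x i j\<bar>) * C"
              unfolding norm_scaleR e_def
              by (rule mult_mono) (use Xle[OF t1, of i i' j j'] True norm_basis_le \<epsilon> \<eta> in auto)
            also have "\<dots> = ?d / \<epsilon> * (C / c) * (c * \<bar>x i j\<bar>)"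
              using c by simp
            also have "\<dots> \<le> ?d / \<epsilon> * (C / c) * norm z"
              using \<epsilon> \<eta> C c x_le \<open>i \<in> _\<close> \<open>j \<in> _\<close> by (intro mult_left_mono) auto
            finally show ?thesis
              using True by (simp add: K_def mult_ac)
          next
            case False
            then show ?thesis
              using K by auto
          qed
        qed
        also have "\<dots> = ?S * (?S * (?S * (?S * (K * norm z))))"
          by (simp only: sum_distrib_left[symmetric] sum_distrib_right[symmetric])
        also have "\<dots> \<le> 2 * (2 * (2 * (2 * (K * norm z))))"
          using S K by (intro mult_mono) auto
        finally show "norm (\<Sum>i'<L. \<Sum>j'<L. \<Sum>i<L. \<Sum>j<L. if i \<noteq> i' \<and> j \<noteq> j' then X i j i' j' *\<^sub>R e i' j' else 0)
            \<le> 16 * K * norm z"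
          by simp
        have two: "(\<Sum>j<L. \<Sum>j'<L. ?h j * (?h j' * (K * norm z))) \<le> 4 * K * norm z"
        proof -
          have "(\<Sum>j<L. \<Sum>j'<L. ?h j * (?h j' * (K * norm z))) = ?S * (?S * (K * norm z))"
            by (simp only: sum_distrib_left[symmetric] sum_distrib_right[symmetric])
          also have "\<dots> \<le> 2 * (2 * (K * norm z))"
            using S K by (intro mult_mono) auto
          finally show ?thesis
            by simp
        qed
        have inj': "inj_on a {..<L}" "inj_on b {..<L}"
          using inj by (auto intro: inj_on_subset)
        \<comment> \<open>For fixed \<open>j \<noteq> j'\<close> the entries are small only
          uniformly in \<open>i\<close>, so the sum over \<open>i\<close> is estimated as a whole
          row; the geometric decay is in \<open>j\<close> and \<open>j'\<close> alone and gives
          4.\<close>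
        have "norm (\<Sum>j<L. \<Sum>j'<L. \<Sum>i<L. if j \<noteq> j' then X i j i j' *\<^sub>R e i j' else 0)
            \<le> (\<Sum>j<L. \<Sum>j'<L. ?h j * (?h j' * (K * norm z)))"
        proof (intro sum_norm_le)
          fix j j' assume "j \<in> {..<L}" "j' \<in> {..<L}"
          show "norm (\<Sum>i<L. if j \<noteq> j' then X i j i j' *\<^sub>R e i j' else 0) \<le> ?h j * (?h j' * (K * norm z))"
          proof (cases "j = j'")
            case False
            have "norm (\<Sum>i<L. X i j i j' *\<^sub>R E (a i, b j')) \<le>
                C / c * (dev \<eta> j j' / \<epsilon>) * norm (\<Sum>v\<in>square a b L. coord v z *\<^sub>R E v)"
            proof (rule norm_row_shift[OF _ inj'(1) finite_square, of "b j"])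
              show "(\<lambda>i. (a i, b j)) ` {..<L} \<subseteq> square a b L"
                using \<open>j \<in> _\<close> by (auto simp: square_def)
              show "\<bar>X i j i j'\<bar> \<le> dev \<eta> j j' / \<epsilon> * \<bar>coord (a i, b j) z\<bar>" for i
                using Xle[OF t2[OF False, of i]] by (simp add: x_def)
            qed (use \<epsilon> \<eta> in auto)
            then show ?thesis
              using False by (simp add: e_def K_def mult_ac norm_z[symmetric])
          qed (use K in simp)
        qed
        with two show "norm (\<Sum>i'<L. \<Sum>j'<L. \<Sum>i<L. \<Sum>j<L. if i = i' \<and> j \<noteq> j' then X i j i' j' *\<^sub>R e i' j' else 0)
            \<le> 4 * K * norm z"
          by (subst sum_collapse_first) auto
        have "norm (\<Sum>i<L. \<Sum>i'<L. \<Sum>j<L. if i \<noteq> i' then X i j i' j *\<^sub>R e i' j else 0)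
            \<le> (\<Sum>i<L. \<Sum>i'<L. ?h i * (?h i' * (K * norm z)))"
        proof (intro sum_norm_le)
          fix i i' assume "i \<in> {..<L}" "i' \<in> {..<L}"
          show "norm (\<Sum>j<L. if i \<noteq> i' then X i j i' j *\<^sub>R e i' j else 0) \<le> ?h i * (?h i' * (K * norm z))"
          proof (cases "i = i'")
            case False
            have "norm (\<Sum>j<L. X i j i' j *\<^sub>R E (a i', b j)) \<le>
                C / c * (dev \<eta> i i' / \<epsilon>) * norm (\<Sum>v\<in>square a b L. coord v z *\<^sub>R E v)"
            proof (rule norm_column_shift[OF _ inj'(2) finite_square, of "a i"])
              show "(\<lambda>j. (a i, b j)) ` {..<L} \<subseteq> square a b L"
                using \<open>i \<in> _\<close> by (auto simp: square_def)
              show "\<bar>X i j i' j\<bar> \<le> dev \<eta> i i' / \<epsilon> * \<bar>coord (a i, b j) z\<bar>" for j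
                using Xle[OF t3[OF False, of j]] by (simp add: x_def)
            qed (use \<epsilon> \<eta> in auto)
            then show ?thesis
              using False by (simp add: e_def K_def mult_ac norm_z[symmetric])
          qed (use K in simp)
        qed
        with two show "norm (\<Sum>i'<L. \<Sum>j'<L. \<Sum>i<L. \<Sum>j<L. if i \<noteq> i' \<and> j = j' then X i j i' j' *\<^sub>R e i' j' else 0)
            \<le> 4 * K * norm z"
          by (subst sum_collapse_second) auto
      qed
      finally show ?case
        by simp
    qed
  qed
  have "continuous_on UNIV (\<lambda>z. norm (U (T z) - z) - 24 * K * norm z)"
    by (intro continuous_intros T.continuous_on U.continuous_on)
  then have "continuous_on (closure (rect_span a b)) (\<lambda>z. norm (U (T z) - z) - 24 * K * norm z)"
    by (rule continuous_on_subset) simp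
  from continuous_le_on_closure[OF this z, of 0] main
  have "norm (U (T z) - z) - 24 * K * norm z \<le> 0"
    by simp
  then show ?thesis
    by (simp add: K_def)
qed

text \<open>If \<open>n\<close> coordinates exceed \<open>\<delta>\<close>, the fourth term of the
  norm is at least \<open>\<delta> * n powr (1 / p)\<close>, while the norm of the coefficients is
  at most \<open>C / c\<^sup>2 * norm z\<close>.\<close>

lemma coord_thin:
  assumes h: "inj h"
  shows "thin (\<lambda>\<delta>. (C / c\<^sup>2 * norm z / \<delta>) powr p) (\<lambda>k. coord (h k) z)"
  unfolding thin_def
proof (intro allI impI)
  fix \<delta> :: real and F :: "nat set"
  assume \<delta>: "0 < \<delta>" and F: "finite F" and large: "\<forall>k\<in>F. \<delta> < \<bar>coord (h k) z\<bar>"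
  let ?G = "h ` F"
  define R where "R = C / c\<^sup>2 * norm z"
  have G: "finite ?G" "card ?G = card F"
    using F h by (auto simp: card_image inj_on_def dest: injD)
  have p0: "0 < p"
    using p by simp
  have R: "0 \<le> R"
    using C by (simp add: R_def)
  have "real (card F) * \<delta> powr p = (\<Sum>u\<in>?G. \<delta> powr p)"
    by (simp add: G)
  also have "\<dots> \<le> (\<Sum>u\<in>?G. \<bar>restr ?G (\<lambda>v. coord v z) u\<bar> powr p)"
    using large \<delta> p0 by (intro sum_mono powr_mono2) (auto simp: restr_def intro: less_imp_le)
  finally have "(real (card F) * \<delta> powr p) powr (1 / p) \<le>
      (\<Sum>u\<in>?G. \<bar>restr ?G (\<lambda>v. coord v z) u\<bar> powr p) powr (1 / p)"
    using p0 by (intro powr_mono2) auto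
  also have "\<dots> \<le> Xp_tensor_norm p w (restr ?G (\<lambda>v. coord v z))"
    by (rule powr_sum_le_Xp_tensor_norm[OF p0 G(1)]) (simp add: restr_def)
  also have "\<dots> \<le> R"
    using Xp_tensor_norm_coords_le[OF G(1), of z] c by (simp add: R_def field_simps power2_eq_square)
  finally have "((real (card F) * \<delta> powr p) powr (1 / p)) powr p \<le> R powr p"
    using p0 by (intro powr_mono2) auto
  then have "real (card F) * \<delta> powr p \<le> R powr p"
    using p0 by (simp add: powr_powr)
  then have "real (card F) \<le> R powr p / \<delta> powr p"
    using \<delta> by (simp add: field_simps)
  then show "real (card F) \<le> (C / c\<^sup>2 * norm z / \<delta>) powr p"
    unfolding R_def[symmetric] using \<delta> R by (simp add: powr_divide)
qed

text \<open>Testing \<open>f\<close> on the sign sum over \<open>n\<close> indices where it exceeds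
  \<open>\<delta>\<close> gives \<open>\<delta> * n \<le> M * C * sqrt n\<close>, the growth
  \<open>sqrt n\<close> being supplied by \<open>h\<close>.\<close>

lemma functional_thin:
  assumes f: "bounded_linear f" "\<And>z. \<bar>f z :: real\<bar> \<le> M * norm z" and M: "0 \<le> M"
    and h: "\<And>F g. finite F \<Longrightarrow> (\<And>i. \<bar>g i\<bar> \<le> 1) \<Longrightarrow> norm (\<Sum>i\<in>F. g i *\<^sub>R e i) \<le> C * sqrt (card F)"
  shows "thin (\<lambda>\<delta>. (M * C / \<delta>)\<^sup>2) (\<lambda>k. f (e k))"
  unfolding thin_def
proof (intro allI impI)
  interpret f: bounded_linear f by (rule f(1))
  fix \<delta> :: real and F :: "nat set"
  assume \<delta>: "0 < \<delta>" and F: "finite F" and large: "\<forall>k\<in>F. \<delta> < \<bar>f (e k)\<bar>"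
  have "\<delta> * real (card F) = (\<Sum>k\<in>F. \<delta>)"
    by simp
  also have "\<dots> \<le> (\<Sum>k\<in>F. \<bar>f (e k)\<bar>)"
    using large by (intro sum_mono) (auto intro: less_imp_le)
  also have "\<dots> = f (\<Sum>k\<in>F. sgn (f (e k)) *\<^sub>R e k)"
    by (simp add: f.sum f.scaleR abs_sgn mult.commute)
  also have "\<dots> \<le> M * (C * sqrt (card F))"
    by (rule order_trans[OF abs_ge_self order_trans[OF f(2) mult_left_mono[OF h]]])
      (use F M in \<open>auto simp: sgn_if\<close>)
  finally have *: "\<delta> * real (card F) \<le> M * C * sqrt (card F)"
    by (simp add: mult.assoc)
  show "real (card F) \<le> (M * C / \<delta>)\<^sup>2"
  proof (cases "card F = 0")
    case False
    then have pos: "0 < sqrt (card F)"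
      by simp
    have "\<delta> * sqrt (card F) * sqrt (card F) \<le> M * C * sqrt (card F)"
      using * by (simp add: mult.assoc)
    then have "\<delta> * sqrt (card F) \<le> M * C"
      using pos by simp
    then have "sqrt (card F) \<le> M * C / \<delta>"
      using \<delta> by (simp add: field_simps)
    from power_mono[OF this, of 2] show ?thesis
      by simp
  qed simp
qed

lemma row_signs: "inj h \<Longrightarrow> finite F \<Longrightarrow> (\<And>i. \<bar>g i\<bar> \<le> 1) \<Longrightarrow> norm (\<Sum>i\<in>F. g i *\<^sub>R E (h i, b)) \<le> C * sqrt (card F)"
  by (rule order_trans[OF norm_row_le mult_left_mono[OF Xp_norm_image_le_sqrt_card]])
    (use C in \<open>auto intro: inj_on_subset\<close>)

lemma column_signs: "inj h \<Longrightarrow> finite F \<Longrightarrow> (\<And>i. \<bar>g i\<bar> \<le> 1) \<Longrightarrow> norm (\<Sum>i\<in>F. g i *\<^sub>R E (b, h i)) \<le> C * sqrt (card F)"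
  by (rule order_trans[OF norm_column_le mult_left_mono[OF Xp_norm_image_le_sqrt_card]])
    (use C in \<open>auto intro: inj_on_subset\<close>)

lemma coord_le: "\<bar>coord u z\<bar> \<le> C / c\<^sup>2 * norm z"
proof -
  have "\<bar>restr {u} (\<lambda>v. coord v z) u\<bar> \<le> Xp_tensor_norm p w (restr {u} (\<lambda>v. coord v z))"
    by (rule coord_le_Xp_tensor_norm) (use p in \<open>simp_all add: finsupp_restr\<close>)
  also have "\<dots> \<le> C / c\<^sup>2 * norm z"
    using Xp_tensor_norm_coords_le[of "{u}" z] c by (simp add: field_simps power2_eq_square)
  finally show ?thesis
    by (simp add: restr_def)
qed

end

text \<open>A moving output index is governed by \<open>coord_thin\<close>, a moving input index by
  \<open>functional_thin\<close>. The sum of the two bounds is one function valid whatever the fixed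
  indices are, as the passage to limits requires.\<close>

lemma (in Xp_tensor_space) matrix_bounds:
  fixes T :: "'e \<Rightarrow> 'e"
  assumes T: "bounded_linear T"
  obtains R where "\<And>a b a' b'. \<bar>coord (a', b') (T (E (a, b)))\<bar> \<le> R"
    and "\<And>h a b. inj h \<Longrightarrow> thin (\<lambda>\<delta>. (R / \<delta>) powr p + (R / \<delta>)\<^sup>2) (\<lambda>k. coord (h k) (T (E (a, b))))"
    and "\<And>h u b. inj h \<Longrightarrow> thin (\<lambda>\<delta>. (R / \<delta>) powr p + (R / \<delta>)\<^sup>2) (\<lambda>k. coord u (T (E (h k, b))))"
    and "\<And>h u b. inj h \<Longrightarrow> thin (\<lambda>\<delta>. (R / \<delta>) powr p + (R / \<delta>)\<^sup>2) (\<lambda>k. coord u (T (E (b, h k))))"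
proof -
  obtain N where N: "0 < N" "\<And>z. norm (T z) \<le> norm z * N"
    using bounded_linear.pos_bounded[OF T] by blast
  define M where "M = C / c\<^sup>2 * N"
  have M: "0 \<le> M"
    using C N(1) by (simp add: M_def)
  have Tle: "C / c\<^sup>2 * norm (T z) \<le> M * norm z" for z
    using N(2)[of z] C by (simp add: M_def mult_ac mult_left_mono divide_right_mono)
  have fle: "\<bar>coord u (T z)\<bar> \<le> M * norm z" for u z
    using coord_le[of u "T z"] Tle[of z] by linarith
  have Ele: "M * norm (E u) \<le> M * C" for u
    using M norm_basis_le by (rule mult_left_mono[rotated])
  show ?thesis
  proof (rule that[of "M * C"])
    show "\<bar>coord (a', b') (T (E (a, b)))\<bar> \<le> M * C" for a b a' b'
      using fle Ele by (rule order_trans)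
    fix h :: "nat \<Rightarrow> 'i \<times> 'i" and a b :: 'i assume "inj h"
    show "thin (\<lambda>\<delta>. (M * C / \<delta>) powr p + (M * C / \<delta>)\<^sup>2) (\<lambda>k. coord (h k) (T (E (a, b))))"
    proof (rule thin_mono[OF coord_thin[OF \<open>inj h\<close>]])
      fix \<delta> :: real assume \<delta>: "0 < \<delta>"
      have "C / c\<^sup>2 * norm (T (E (a, b))) \<le> M * C"
        using Tle Ele by (rule order_trans)
      then have "(C / c\<^sup>2 * norm (T (E (a, b))) / \<delta>) powr p \<le> (M * C / \<delta>) powr p"
        using \<delta> p C by (intro powr_mono2 divide_right_mono) auto
      then show "(C / c\<^sup>2 * norm (T (E (a, b))) / \<delta>) powr p \<le> (M * C / \<delta>) powr p + (M * C / \<delta>)\<^sup>2"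
        by (simp add: add_increasing2)
    qed
  next
    fix h :: "nat \<Rightarrow> 'i" and b :: 'i and u assume "inj h"
    have f: "bounded_linear (\<lambda>z. coord u (T z))"
      by (rule bounded_linear_compose[OF coord_linear T])
    show "thin (\<lambda>\<delta>. (M * C / \<delta>) powr p + (M * C / \<delta>)\<^sup>2) (\<lambda>k. coord u (T (E (h k, b))))"
      by (rule thin_mono[OF functional_thin[OF f fle M row_signs[OF \<open>inj h\<close>]]]) simp_all
    show "thin (\<lambda>\<delta>. (M * C / \<delta>) powr p + (M * C / \<delta>)\<^sup>2) (\<lambda>k. coord u (T (E (b, h k))))"
      by (rule thin_mono[OF functional_thin[OF f fle M column_signs[OF \<open>inj h\<close>]]]) simp_all
  qed
qed

section \<open>Choice of the constants, the inverse of the diagonal and the conclusion\<close>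

theorem proposition6p3:
  fixes p :: real
    and w :: "nat \<Rightarrow> real"
    and x :: "nat \<times> nat \<Rightarrow> 'x::banach"
    and y :: "nat \<times> nat \<Rightarrow> 'y::banach"
    and tens :: "'x \<Rightarrow> 'y \<Rightarrow> 'e::banach"
    and T :: "'e \<Rightarrow> 'e"
    and \<epsilon> :: real
  assumes "2 < p"
    and "\<And>n. 0 < w n \<and> w n \<le> 1" and "decseq w" and "w \<longlonglongrightarrow> 0"
    and "Xp_tensor_product p (\<lambda>(n, k). w n) x y tens"
    and "bounded_linear T"
    and "\<epsilon> > 0"
    and "\<And>n k m j.
           \<bar>coord_functional (tensor_basis tens x y) ((n, k), (m, j))
              (T (tens (x (n, k)) (y (m, j))))\<bar> \<ge> \<epsilon>"
  shows "\<exists>K J. rich K \<and> rich J \<and>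
           (let Z = closure (span {tens (x (n, k)) (y (m, j)) | n k m j.
                                     (n, k) \<in> K \<and> (m, j) \<in> J})
            in isomorphism_into_on Z T \<and> complemented (T ` Z))"
proof -
  let ?E = "tensor_basis tens x y" and ?w = "\<lambda>(n, k). w n"
  obtain c C where "0 < c" "0 < C"
    "\<And>a. finsupp a \<Longrightarrow> c * Xp_tensor_norm p ?w a \<le> norm (lincomb ?E a)"
    "\<And>a. finsupp a \<Longrightarrow> norm (lincomb ?E a) \<le> C * Xp_tensor_norm p ?w a"
    "closure (span (range ?E)) = UNIV"
    using assms(5) unfolding Xp_tensor_product_def completion_basis_equiv_def by blast
  then interpret Xp_tensor_space p ?w ?E c C
    using assms(1,2) by unfold_locales auto
  define t where "t = (\<lambda>a b a' b'. coord (a', b') (T (?E (a, b))))"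
  obtain R where R: "\<And>a b a' b'. \<bar>coord (a', b') (T (?E (a, b)))\<bar> \<le> R"
    "\<And>h a b. inj h \<Longrightarrow> thin (\<lambda>\<delta>. (R / \<delta>) powr p + (R / \<delta>)\<^sup>2) (\<lambda>k. coord (h k) (T (?E (a, b))))"
    "\<And>h u b. inj h \<Longrightarrow> thin (\<lambda>\<delta>. (R / \<delta>) powr p + (R / \<delta>)\<^sup>2) (\<lambda>k. coord u (T (?E (h k, b))))"
    "\<And>h u b. inj h \<Longrightarrow> thin (\<lambda>\<delta>. (R / \<delta>) powr p + (R / \<delta>)\<^sup>2) (\<lambda>k. coord u (T (?E (b, h k))))"
    using that by (rule matrix_bounds[OF assms(6)])
  let ?B = "\<lambda>\<delta>. (R / \<delta>) powr p + (R / \<delta>)\<^sup>2"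
  \<comment> \<open>Makes \<open>24 * (C / c) * (\<eta> / \<epsilon>)\<close> equal to 1/2.\<close>
  define \<eta> where "\<eta> = \<epsilon> * c / (48 * C)"
  have \<eta>: "0 < \<eta>"
    using assms(7) c C by (simp add: \<eta>_def)
  have inj1: "inj (\<lambda>k. (n, k))" "inj (\<lambda>k. ((n, k), b))" "inj (\<lambda>k. (b, (n, k)))"
    for n :: nat and b :: "nat \<times> nat"
    by (auto simp: inj_def)
  have bd: "\<bar>t a b a' b'\<bar> \<le> R" for a b a' b'
    using R(1) by (simp add: t_def)
  \<comment> \<open>Four cases: the index of either factor moves inside a column, on the input or on
    the output side.\<close>
  have thin: "columns_thin ?B (\<lambda>a a'. t a b a' b')" "columns_thin ?B (\<lambda>b b'. t a b a' b')" for a a' b b'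
    unfolding columns_thin_def t_def
    using R(2)[OF inj1(2)] R(2)[OF inj1(3)] R(3)[OF inj1(1)] R(4)[OF inj1(1)] by blast+
  obtain a b where inj: "inj a" "inj b" and rich: "rich (range a)" "rich (range b)"
    and t1: "\<And>i i' j j'. i \<noteq> i' \<Longrightarrow> j \<noteq> j' \<Longrightarrow> \<bar>t (a i) (b j) (a i') (b j')\<bar> \<le> dev (dev \<eta> i i') j j'"
    and t2: "\<And>i j j'. j \<noteq> j' \<Longrightarrow> \<bar>t (a i) (b j) (a i) (b j')\<bar> \<le> dev \<eta> j j'"
    and t3: "\<And>i i' j. i \<noteq> i' \<Longrightarrow> \<bar>t (a i) (b j) (a i') (b j)\<bar> \<le> dev \<eta> i i'"
    using that by (rule rich_selection[of \<eta> t R ?B, OF \<eta> bd thin])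
  define Z where "Z = closure (rect_span a b)"
  have Z_eq: "Z = closure (span {tens (x (n, k)) (y (m, j)) | n k m j. (n, k) \<in> range a \<and> (m, j) \<in> range b})"
  proof -
    have "{?E (a i, b j) | i j. True} = {tens (x (n, k)) (y (m, j)) | n k m j. (n, k) \<in> range a \<and> (m, j) \<in> range b}"
    proof safe
      fix i j
      show "\<exists>n k m l. ?E (a i, b j) = tens (x (n, k)) (y (m, l)) \<and> (n, k) \<in> range a \<and> (m, l) \<in> range b"
        by (rule exI[of _ "fst (a i)"], rule exI[of _ "snd (a i)"], rule exI[of _ "fst (b j)"],
            rule exI[of _ "snd (b j)"]) (simp add: tensor_basis_def)
    next
      fix n k m l i j assume "(n, k) = a i" "(m, l) = b j"
      then show "\<exists>i j. tens (x (n, k)) (y (m, l)) = ?E (a i, b j) \<and> True"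
        by (rule_tac exI[of _ i], rule_tac exI[of _ j]) (simp add: tensor_basis_def)
    qed
    then show ?thesis
      by (simp only: Z_def)
  qed
  \<comment> \<open>On the selected indices the reciprocal is at most \<open>1 / \<epsilon>\<close>
    in modulus; the value 0 elsewhere makes \<open>U\<close> map into \<open>Z\<close>.\<close>
  define m where "m v = (if v \<in> range a \<times> range b then 1 / coord v (T (?E v)) else 0)" for v
  have diag: "\<epsilon> \<le> \<bar>coord v (T (?E v))\<bar>" for v
    using assms(8)[of "fst (fst v)" "snd (fst v)" "fst (snd v)" "snd (snd v)"]
    by (simp add: tensor_basis_def case_prod_unfold)
  have m_le: "\<bar>m v\<bar> \<le> 1 / \<epsilon>" for v
    using diag[of v] assms(7) by (auto simp: m_def intro: divide_left_mono)
  have m_diag: "m (a i, b j) * t (a i) (b j) (a i) (b j) = 1" for i j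
    using diag[of "(a i, b j)"] assms(7) by (auto simp: m_def t_def)
  obtain U where U: "bounded_linear U" "\<And>v. U (?E v) = m v *\<^sub>R ?E v" "\<And>v z. coord v (U z) = m v * coord v z"
    using multiplier_exists[of m, OF m_le] by blast
  have Z: "subspace Z" "closed Z"
    by (simp_all add: Z_def subspace_closure)
  have UZ: "range U \<subseteq> Z"
  proof -
    have "U ` range ?E \<subseteq> Z"
    proof safe
      fix v
      show "U (?E v) \<in> Z"
      proof (cases "v \<in> range a \<times> range b")
        case True
        then obtain i j where "v = (a i, b j)"
          by blast
        then have "?E v \<in> Z"
          unfolding Z_def by (intro subsetD[OF closure_subset] span_base) blast
        then show ?thesis
          using Z(1) by (simp add: U(2) subspace_scale)
      next
        case False
        then show ?thesis
          using Z(1) by (simp add: U(2) m_def subspace_0)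
      qed
    qed
    \<comment> \<open>From the basis vectors the inclusion passes to the span by linearity, and to
      the whole space because \<open>U\<close> is continuous and \<open>Z\<close> closed.\<close>
    then have "U ` span (range ?E) \<subseteq> Z"
      using span_minimal[OF _ Z(1)] linear_span_image[OF bounded_linear.linear[OF U(1)]] by metis
    then have "U ` closure (span (range ?E)) \<subseteq> Z"
      using Z(2) U(1) by (intro image_closure_subset linear_continuous_on)
    then show ?thesis
      by (simp add: dense)
  qed
  have near: "norm (U (T z) - z) \<le> norm z / 2" if "z \<in> Z" for z
  proof -
    have "norm (U (T z) - z) \<le> 24 * (C / c) * (\<eta> / \<epsilon>) * norm z"
      using norm_near_identity_le[OF assms(6) inj assms(7) less_imp_le[OF \<eta>] _ m_le U(1,3)] m_diag UZ t1 t2 t3 that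
      unfolding t_def Z_def by blast
    also have "24 * (C / c) * (\<eta> / \<epsilon>) = 1 / 2"
      using C c assms(7) by (simp add: \<eta>_def)
    finally show ?thesis
      by simp
  qed
  have "isomorphism_into_on Z T \<and> complemented (T ` Z)"
    using small_perturbation_invertible[OF Z assms(6) U(1) UZ near] by blast
  then show ?thesis
    using rich unfolding Let_def Z_eq by blast
qed

end
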